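(* Let $p$ be a prime and let $s$ be a generalized $n$-series over a commutative ring $R$ such that $s(1)$ is a unit in $R/s(p)$. Then for each $i$ there is a canonical isomorphism $$s\Omega^i_{\mathbf{A}^1}\otimes_RR/s(p)\cong\mathrm{H}^i\bigl(s\Omega_{\mathbf{A}^1}\otimes_RR/s(p)\bigr)$$ sending $x^n\mapsto x^{np}$ in degree zero and $x^n\,dx\mapsto[x^{np}x^{p-1}dx]$ in degree one.
   Context: A generalized $n$-series over $R$ is a function $s:\mathbf{Z}_{\ge 0}\to R$ with $s(0)=0$, $s(n)$ not a zero-divisor for any $n>0$, and $s(n-k)\mid s(n)-s(k)$ for all $n>k>0$. The $s$-de Rham complex of $\mathbf{A}^1=\mathrm{Spec}\,R[x]$ is the two-term complex (degrees $0,1$) $s\Omega_{\mathbf{A}^1}=(R[x]\xrightarrow{\nabla_s}R[x]\,dx)$ with $\nabla_s$ the $R$-linear map $x^n\mapsto s(n)x^{n-1}dx$; $s\Omega^i_{\mathbf{A}^1}$ is its degree $i$ term. The isomorphism is $R$-linear. *)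

theory Defs
  imports "HOL-Algebra.UnivPoly" "HOL-Algebra.QuotRing" "HOL-Algebra.Divisibility"
    "HOL-Computational_Algebra.Primes"
begin

definition module_hom ::
  "[('a, 'x) ring_scheme, ('a, 'm, 'y) module_scheme, ('a, 'n, 'z) module_scheme] \<Rightarrow> ('m \<Rightarrow> 'n) set"
  where "module_hom R M N =
    {\<phi> \<in> carrier M \<rightarrow> carrier N.
      (\<forall>x\<in>carrier M. \<forall>y\<in>carrier M. \<phi> (x \<oplus>\<^bsub>M\<^esub> y) = \<phi> x \<oplus>\<^bsub>N\<^esub> \<phi> y) \<and>
      (\<forall>r\<in>carrier R. \<forall>x\<in>carrier M. \<phi> (r \<odot>\<^bsub>M\<^esub> x) = r \<odot>\<^bsub>N\<^esub> \<phi> x)}"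

definition module_iso ::
  "[('a, 'x) ring_scheme, ('a, 'm, 'y) module_scheme, ('a, 'n, 'z) module_scheme] \<Rightarrow> ('m \<Rightarrow> 'n) set"
  where "module_iso R M N = {\<phi> \<in> module_hom R M N. bij_betw \<phi> (carrier M) (carrier N)}"

definition generated_submodule ::
  "[('a, 'x) ring_scheme, ('a, 'm, 'y) module_scheme, 'm set] \<Rightarrow> 'm set"
  where "generated_submodule R M X = \<Inter>{H. submodule H R M \<and> X \<subseteq> H}"

text \<open>The record of modules extends that of rings; the multiplicative fields are irrelevant for
  modules and are left unspecified in the constructions below.\<close>

definition quotient_module :: "[('a, 'm, 'y) module_scheme, 'm set] \<Rightarrow> ('a, 'm set) module"
  where "quotient_module M N =
    \<lparr>carrier = a_rcosets\<^bsub>M\<^esub> N, monoid.mult = undefined, one = undefined,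
     zero = N, add = set_add M,
     smult = (\<lambda>r A. \<Union>x\<in>A. N +>\<^bsub>M\<^esub> (r \<odot>\<^bsub>M\<^esub> x))\<rparr>"

definition quotient_ring_module :: "[('a, 'x) ring_scheme, 'a set] \<Rightarrow> ('a, 'a set) module"
  where "quotient_ring_module R I =
    \<lparr>carrier = carrier (R Quot I), monoid.mult = monoid.mult (R Quot I), one = \<one>\<^bsub>R Quot I\<^esub>,
     zero = \<zero>\<^bsub>R Quot I\<^esub>, add = add (R Quot I),
     smult = (\<lambda>r A. (I +>\<^bsub>R\<^esub> r) \<otimes>\<^bsub>R Quot I\<^esub> A)\<rparr>"

text \<open>Elements of the free module on \<open>S\<close> are the finitely supported functions on \<open>S\<close>,
  extended by zero outside \<open>S\<close>.\<close>

definition free_module :: "[('a, 'x) ring_scheme, 's set] \<Rightarrow> ('a, 's \<Rightarrow> 'a) module"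
  where "free_module R S =
    \<lparr>carrier = {f. (\<forall>q\<in>S. f q \<in> carrier R) \<and> (\<forall>q. q \<notin> S \<longrightarrow> f q = \<zero>\<^bsub>R\<^esub>)
                  \<and> finite {q. f q \<noteq> \<zero>\<^bsub>R\<^esub>}},
     monoid.mult = undefined, one = undefined,
     zero = (\<lambda>q. \<zero>\<^bsub>R\<^esub>), add = (\<lambda>f g q. f q \<oplus>\<^bsub>R\<^esub> g q),
     smult = (\<lambda>r f q. r \<otimes>\<^bsub>R\<^esub> f q)\<rparr>"

definition free_gen :: "[('a, 'x) ring_scheme, 's] \<Rightarrow> 's \<Rightarrow> 'a"
  where "free_gen R q = (\<lambda>q'. if q' = q then \<one>\<^bsub>R\<^esub> else \<zero>\<^bsub>R\<^esub>)"

definition tensor_relations ::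
  "[('a, 'x) ring_scheme, ('a, 'm, 'y) module_scheme, ('a, 'n, 'z) module_scheme] \<Rightarrow>
    ('m \<times> 'n \<Rightarrow> 'a) set"
  where "tensor_relations R M N =
    (let F = free_module R (carrier M \<times> carrier N); e = free_gen R in
      {e (m \<oplus>\<^bsub>M\<^esub> m', n) \<ominus>\<^bsub>F\<^esub> (e (m, n) \<oplus>\<^bsub>F\<^esub> e (m', n)) | m m' n.
         m \<in> carrier M \<and> m' \<in> carrier M \<and> n \<in> carrier N} \<union>
      {e (m, n \<oplus>\<^bsub>N\<^esub> n') \<ominus>\<^bsub>F\<^esub> (e (m, n) \<oplus>\<^bsub>F\<^esub> e (m, n')) | m n n'.
         m \<in> carrier M \<and> n \<in> carrier N \<and> n' \<in> carrier N} \<union>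
      {e (r \<odot>\<^bsub>M\<^esub> m, n) \<ominus>\<^bsub>F\<^esub> (r \<odot>\<^bsub>F\<^esub> e (m, n)) | r m n.
         r \<in> carrier R \<and> m \<in> carrier M \<and> n \<in> carrier N} \<union>
      {e (m, r \<odot>\<^bsub>N\<^esub> n) \<ominus>\<^bsub>F\<^esub> (r \<odot>\<^bsub>F\<^esub> e (m, n)) | r m n.
         r \<in> carrier R \<and> m \<in> carrier M \<and> n \<in> carrier N})"

definition tensor_kernel ::
  "[('a, 'x) ring_scheme, ('a, 'm, 'y) module_scheme, ('a, 'n, 'z) module_scheme] \<Rightarrow>
    ('m \<times> 'n \<Rightarrow> 'a) set"
  where "tensor_kernel R M N =
    generated_submodule R (free_module R (carrier M \<times> carrier N)) (tensor_relations R M N)"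

definition tensor_product ::
  "[('a, 'x) ring_scheme, ('a, 'm, 'y) module_scheme, ('a, 'n, 'z) module_scheme] \<Rightarrow>
    ('a, ('m \<times> 'n \<Rightarrow> 'a) set) module"
  where "tensor_product R M N =
    quotient_module (free_module R (carrier M \<times> carrier N)) (tensor_kernel R M N)"

definition pure_tensor ::
  "[('a, 'x) ring_scheme, ('a, 'm, 'y) module_scheme, ('a, 'n, 'z) module_scheme, 'm, 'n] \<Rightarrow>
    ('m \<times> 'n \<Rightarrow> 'a) set"
  where "pure_tensor R M N m n =
    tensor_kernel R M N +>\<^bsub>free_module R (carrier M \<times> carrier N)\<^esub> free_gen R (m, n)"

text \<open>The map \<open>g \<otimes> h\<close> into \<open>M' \<otimes> N'\<close> induced by linear maps \<open>g\<close> (to \<open>M'\<close>) and \<open>h\<close> (to \<open>N'\<close>):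
  a class represented by \<open>f\<close> goes to the sum of the \<open>f (m, n) \<cdot> (g m \<otimes> h n)\<close>, which is the
  same for every representative.\<close>

definition tensor_map ::
  "[('a, 'x) ring_scheme, ('a, 'm2, 'y) module_scheme, ('a, 'n2, 'z) module_scheme,
    'm \<Rightarrow> 'm2, 'n \<Rightarrow> 'n2] \<Rightarrow> ('m \<times> 'n \<Rightarrow> 'a) set \<Rightarrow> ('m2 \<times> 'n2 \<Rightarrow> 'a) set"
  where "tensor_map R M' N' g h A =
    the_elem ((\<lambda>f. \<Oplus>\<^bsub>tensor_product R M' N'\<^esub>q\<in>{q. f q \<noteq> \<zero>\<^bsub>R\<^esub>}.
      f q \<odot>\<^bsub>tensor_product R M' N'\<^esub> pure_tensor R M' N' (g (fst q)) (h (snd q))) ` A)"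

record ('a, 'm, 'y) cochain_complex =
  cterm :: "int \<Rightarrow> ('a, 'm, 'y) module_scheme"
  cdiff :: "int \<Rightarrow> 'm \<Rightarrow> 'm"

definition cocycles :: "[('a, 'm, 'y) cochain_complex, int] \<Rightarrow> 'm set"
  where "cocycles C i =
    {x \<in> carrier (cterm C i). cdiff C i x = \<zero>\<^bsub>cterm C (i + 1)\<^esub>}"

definition coboundaries :: "[('a, 'm, 'y) cochain_complex, int] \<Rightarrow> 'm set"
  where "coboundaries C i = cdiff C (i - 1) ` carrier (cterm C (i - 1))"

definition cohomology :: "[('a, 'm, 'y) cochain_complex, int] \<Rightarrow> ('a, 'm set) module"
  where "cohomology C i =
    quotient_module ((cterm C i)\<lparr>carrier := cocycles C i\<rparr>) (coboundaries C i)"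

definition cohomology_class :: "[('a, 'm, 'y) cochain_complex, int, 'm] \<Rightarrow> 'm set"
  where "cohomology_class C i x = coboundaries C i +>\<^bsub>cterm C i\<^esub> x"

definition tensor_complex ::
  "[('a, 'x) ring_scheme, ('a, 'm, 'y) cochain_complex, ('a, 'n, 'z) module_scheme] \<Rightarrow>
    ('a, ('m \<times> 'n \<Rightarrow> 'a) set, unit) cochain_complex"
  where "tensor_complex R C N =
    \<lparr>cterm = (\<lambda>i. tensor_product R (cterm C i) N),
     cdiff = (\<lambda>i. tensor_map R (cterm C (i + 1)) N (cdiff C i) id)\<rparr>"

definition generalized_n_series :: "[('a, 'x) ring_scheme, nat \<Rightarrow> 'a] \<Rightarrow> bool"
  where "generalized_n_series R s \<longleftrightarrow>
    s \<in> UNIV \<rightarrow> carrier R \<and>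
    s 0 = \<zero>\<^bsub>R\<^esub> \<and>
    (\<forall>n>0. \<forall>a\<in>carrier R. s n \<otimes>\<^bsub>R\<^esub> a = \<zero>\<^bsub>R\<^esub> \<longrightarrow> a = \<zero>\<^bsub>R\<^esub>) \<and>
    (\<forall>n k. n > k \<and> k > 0 \<longrightarrow> s (n - k) divides\<^bsub>R\<^esub> (s n \<ominus>\<^bsub>R\<^esub> s k))"

text \<open>The free module \<open>R[x] dx\<close> is represented by \<open>R[x]\<close>, with \<open>f\<close> standing for \<open>f dx\<close>.
  The truncated exponent \<open>n - 1\<close> is harmless at \<open>n = 0\<close>, because \<open>s 0\<close> is zero.\<close>

definition sdR_nabla :: "[('a, 'x) ring_scheme, nat \<Rightarrow> 'a, nat \<Rightarrow> 'a] \<Rightarrow> (nat \<Rightarrow> 'a)"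
  where "sdR_nabla R s f =
    (\<Oplus>\<^bsub>UP R\<^esub>n\<in>{..deg R f}. monom (UP R) (coeff (UP R) f n \<otimes>\<^bsub>R\<^esub> s n) (n - 1))"

definition sdR_complex ::
  "[('a, 'x) ring_scheme, nat \<Rightarrow> 'a] \<Rightarrow>
    ('a, nat \<Rightarrow> 'a, \<lparr>monom :: 'a \<Rightarrow> nat \<Rightarrow> nat \<Rightarrow> 'a, coeff :: (nat \<Rightarrow> 'a) \<Rightarrow> nat \<Rightarrow> 'a\<rparr>) cochain_complex"
  where "sdR_complex R s =
    \<lparr>cterm = (\<lambda>i. if i = 0 \<or> i = 1 then UP R else (UP R)\<lparr>carrier := {\<zero>\<^bsub>UP R\<^esub>}\<rparr>),
     cdiff = (\<lambda>i. if i = 0 then sdR_nabla R s else (\<lambda>_. \<zero>\<^bsub>UP R\<^esub>))\<rparr>"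

end

theory Submission
  imports Defs
begin

text \<open>
  Write \<open>a = s p\<close> and \<open>I = (a)\<close>. Everything rests on the values of \<open>s\<close> modulo \<open>I\<close>. Iterating
  \<open>s q \<bar> s (q + k) - s k\<close> shows that \<open>s\<close> is periodic modulo \<open>s q\<close> on positive arguments and that
  \<open>s q\<close> divides \<open>s (q m)\<close>. With \<open>q = p\<close> this says that \<open>s n\<close> is zero modulo \<open>I\<close> when \<open>p\<close> divides
  \<open>n\<close>. When \<open>p\<close> does not divide \<open>n\<close>, choose \<open>m\<close> with \<open>n m = 1 + p y\<close>: then \<open>s n\<close> divides
  \<open>s (n m)\<close>, which is congruent to \<open>s 1\<close>, a unit; so \<open>s n\<close> is a unit modulo \<open>I\<close>
  (\<open>n_series_invertible_mod\<close>). Hence the reduced differential kills each \<open>x^n\<close> with \<open>p \<bar> n\<close>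
  and maps every other \<open>x^n\<close> to a unit multiple of \<open>x^(n-1) dx\<close>. Its kernel is spanned by the
  \<open>x^(np)\<close>, and its cokernel by the \<open>x^(np+p-1) dx\<close>.

  To pass from this computation to tensor products, \<open>m \<mapsto> m \<otimes> 1\<close> is shown to be a surjection of
  \<open>M\<close> onto \<open>M \<otimes> R/(a)\<close> with kernel \<open>aM\<close> (\<open>tensor_one_surj\<close>, \<open>tensor_one_eq_zero_iff\<close>). As these
  surjections commute with the differentials, the cohomology of a reduced complex can be handled
  entirely by representatives in the original complex. An endomorphism \<open>F\<close> of the degree \<open>i\<close> term
  \<open>M\<close> gives two linear maps out of \<open>M\<close>, namely \<open>f \<mapsto> f \<otimes> 1\<close> and \<open>f \<mapsto> [F f \<otimes> 1]\<close>; if both are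
  surjective with the same kernel, they differ by an isomorphism. This is
  \<open>reduction_cohomology_iso\<close>, whose hypotheses are divisibility statements about \<open>F\<close> and the
  differentials. They are checked coefficient by coefficient for the substitutions
  \<open>x^n \<mapsto> x^(np)\<close> in degree 0 and \<open>x^n dx \<mapsto> x^(np+p-1) dx\<close> in degree 1. In the remaining degrees
  all modules are zero, and the identity serves as \<open>F\<close>.
\<close>

section \<open>Linear maps\<close>

lemma module_homD:
  assumes "\<phi> \<in> module_hom R M N"
  shows "x \<in> carrier M \<Longrightarrow> \<phi> x \<in> carrier N"
    and "\<lbrakk>x \<in> carrier M; y \<in> carrier M\<rbrakk> \<Longrightarrow> \<phi> (x \<oplus>\<^bsub>M\<^esub> y) = \<phi> x \<oplus>\<^bsub>N\<^esub> \<phi> y"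
    and "\<lbrakk>r \<in> carrier R; x \<in> carrier M\<rbrakk> \<Longrightarrow> \<phi> (r \<odot>\<^bsub>M\<^esub> x) = r \<odot>\<^bsub>N\<^esub> \<phi> x"
  using assms by (auto simp: module_hom_def)

lemma module_homI:
  assumes "\<And>x. x \<in> carrier M \<Longrightarrow> \<phi> x \<in> carrier N"
    and "\<And>x y. \<lbrakk>x \<in> carrier M; y \<in> carrier M\<rbrakk> \<Longrightarrow> \<phi> (x \<oplus>\<^bsub>M\<^esub> y) = \<phi> x \<oplus>\<^bsub>N\<^esub> \<phi> y"
    and "\<And>r x. \<lbrakk>r \<in> carrier R; x \<in> carrier M\<rbrakk> \<Longrightarrow> \<phi> (r \<odot>\<^bsub>M\<^esub> x) = r \<odot>\<^bsub>N\<^esub> \<phi> x"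
  shows "\<phi> \<in> module_hom R M N"
  using assms by (auto simp: module_hom_def)

lemma module_hom_compose:
  assumes "\<phi> \<in> module_hom R M N" "\<psi> \<in> module_hom R N P"
  shows "(\<lambda>x. \<psi> (\<phi> x)) \<in> module_hom R M P"
  using assms by (auto simp: module_hom_def Pi_iff)

lemma module_hom_zero:
  assumes "module R M" "module R N" "\<phi> \<in> module_hom R M N"
  shows "\<phi> \<zero>\<^bsub>M\<^esub> = \<zero>\<^bsub>N\<^esub>"
proof -
  interpret M: module R M by fact
  interpret N: module R N by fact
  have "\<phi> (\<zero>\<^bsub>R\<^esub> \<odot>\<^bsub>M\<^esub> \<zero>\<^bsub>M\<^esub>) = \<zero>\<^bsub>R\<^esub> \<odot>\<^bsub>N\<^esub> \<phi> \<zero>\<^bsub>M\<^esub>"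
    by (rule module_homD(3)[OF assms(3)]) simp_all
  thus ?thesis by (simp add: module_homD(1)[OF assms(3)])
qed

lemma module_hom_uminus:
  assumes "module R M" "module R N" "\<phi> \<in> module_hom R M N" "x \<in> carrier M"
  shows "\<phi> (\<ominus>\<^bsub>M\<^esub> x) = \<ominus>\<^bsub>N\<^esub> \<phi> x"
proof -
  interpret M: module R M by fact
  interpret N: module R N by fact
  have "\<phi> (\<ominus>\<^bsub>M\<^esub> x) \<oplus>\<^bsub>N\<^esub> \<phi> x = \<zero>\<^bsub>N\<^esub>"
    using module_homD(2)[OF assms(3), of "\<ominus>\<^bsub>M\<^esub> x" x] module_hom_zero[OF assms(1-3)] assms(4)
    by (simp add: M.M.l_neg)
  thus ?thesis using module_homD(1)[OF assms(3)] assms(4) by (simp add: N.M.minus_equality)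
qed

lemma module_hom_minus:
  assumes "module R M" "module R N" "\<phi> \<in> module_hom R M N" "x \<in> carrier M" "y \<in> carrier M"
  shows "\<phi> (x \<ominus>\<^bsub>M\<^esub> y) = \<phi> x \<ominus>\<^bsub>N\<^esub> \<phi> y"
proof -
  interpret M: module R M by fact
  show ?thesis using assms
    by (simp add: a_minus_def module_homD(2)[OF assms(3)] module_hom_uminus)
qed

lemma module_minus_zero_iff:
  assumes "module R M" "x \<in> carrier M" "y \<in> carrier M"
  shows "x \<ominus>\<^bsub>M\<^esub> y = \<zero>\<^bsub>M\<^esub> \<longleftrightarrow> x = y"
proof -
  interpret M: module R M by fact
  show ?thesis using assms
    by (metis M.M.add.inv_closed M.M.minus_equality M.M.minus_minus M.M.r_neg a_minus_def)
qed

lemma submodule_vimage: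
  assumes "module R M" "module R N" "\<phi> \<in> module_hom R M N" "submodule H R N"
  shows "submodule {x \<in> carrier M. \<phi> x \<in> H} R M"
proof -
  interpret M: module R M by fact
  interpret N: module R N by fact
  note H = N.submoduleE[OF assms(4)]
  have z: "\<zero>\<^bsub>N\<^esub> \<in> H" using H(2,3,5) H(1) by (metis N.M.l_neg ex_in_conv subsetD)
  show ?thesis
    by (rule M.submoduleI)
       (auto simp: module_homD[OF assms(3)] module_hom_zero[OF assms(1-3)]
          module_hom_uminus[OF assms(1-3)] z H)
qed

lemma submodule_singleton_zero:
  assumes "module R M"
  shows "submodule {\<zero>\<^bsub>M\<^esub>} R M"
proof -
  interpret M: module R M by fact
  show ?thesis by (rule M.submoduleI) auto
qed

lemma submodule_kernel:
  assumes "module R M" "module R N" "\<phi> \<in> module_hom R M N"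
  shows "submodule {x \<in> carrier M. \<phi> x = \<zero>\<^bsub>N\<^esub>} R M"
  using submodule_vimage[OF assms submodule_singleton_zero[OF assms(2)]] by simp

lemma submodule_image:
  assumes "module R M" "module R N" "\<phi> \<in> module_hom R M N"
  shows "submodule (\<phi> ` carrier M) R N"
proof -
  interpret M: module R M by fact
  interpret N: module R N by fact
  show ?thesis
  proof (rule N.submoduleI)
    show "\<phi> ` carrier M \<subseteq> carrier N" using module_homD(1)[OF assms(3)] by auto
    show "\<zero>\<^bsub>N\<^esub> \<in> \<phi> ` carrier M"
      by (rule image_eqI[of _ _ "\<zero>\<^bsub>M\<^esub>"]) (simp_all add: module_hom_zero[OF assms])
  next
    fix a assume "a \<in> \<phi> ` carrier M"
    then obtain x where x: "x \<in> carrier M" "a = \<phi> x" by blast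
    show "\<ominus>\<^bsub>N\<^esub> a \<in> \<phi> ` carrier M"
      by (rule image_eqI[of _ _ "\<ominus>\<^bsub>M\<^esub> x"]) (simp_all add: x module_hom_uminus[OF assms])
    show "r \<odot>\<^bsub>N\<^esub> a \<in> \<phi> ` carrier M" if "r \<in> carrier R" for r
      by (rule image_eqI[of _ _ "r \<odot>\<^bsub>M\<^esub> x"]) (simp_all add: x that module_homD[OF assms(3)])
    fix b assume "b \<in> \<phi> ` carrier M"
    then obtain y where y: "y \<in> carrier M" "b = \<phi> y" by blast
    show "a \<oplus>\<^bsub>N\<^esub> b \<in> \<phi> ` carrier M"
      by (rule image_eqI[of _ _ "x \<oplus>\<^bsub>M\<^esub> y"]) (simp_all add: x y module_homD[OF assms(3)])
  qed
qed

text \<open>Both targets are quotients of \<open>M\<close> by the same submodule, so sending \<open>\<alpha> x\<close> to \<open>\<beta> x\<close> is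
well defined and bijective. Constructing the isomorphism this way avoids the quotient of \<open>M\<close> itself.\<close>

lemma module_iso_if_equal_kernels:
  assumes M: "module R M" and T: "module R T" and H: "module R H"
    and \<alpha>: "\<alpha> \<in> module_hom R M T" and \<beta>: "\<beta> \<in> module_hom R M H"
    and sa: "\<alpha> ` carrier M = carrier T" and sb: "\<beta> ` carrier M = carrier H"
    and ker: "\<And>x. x \<in> carrier M \<Longrightarrow> \<alpha> x = \<zero>\<^bsub>T\<^esub> \<longleftrightarrow> \<beta> x = \<zero>\<^bsub>H\<^esub>"
  shows "\<exists>\<phi> \<in> module_iso R T H. \<forall>x\<in>carrier M. \<phi> (\<alpha> x) = \<beta> x"
proof -
  interpret M: module R M by fact
  interpret T: module R T by fact
  interpret H: module R H by fact
  note a = module_homD[OF \<alpha>] and b = module_homD[OF \<beta>]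
  have eq: "\<alpha> x = \<alpha> y \<longleftrightarrow> \<beta> x = \<beta> y" if xy: "x \<in> carrier M" "y \<in> carrier M" for x y
  proof -
    have "\<alpha> x = \<alpha> y \<longleftrightarrow> \<alpha> (x \<ominus>\<^bsub>M\<^esub> y) = \<zero>\<^bsub>T\<^esub>"
      by (simp add: module_hom_minus[OF M T \<alpha>] module_minus_zero_iff[OF T] a xy)
    also have "\<dots> \<longleftrightarrow> \<beta> (x \<ominus>\<^bsub>M\<^esub> y) = \<zero>\<^bsub>H\<^esub>" using xy by (intro ker) simp
    also have "\<dots> \<longleftrightarrow> \<beta> x = \<beta> y"
      by (simp add: module_hom_minus[OF M H \<beta>] module_minus_zero_iff[OF H] b xy)
    finally show ?thesis .
  qed
  define \<phi> where "\<phi> t = \<beta> (SOME x. x \<in> carrier M \<and> \<alpha> x = t)" for t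
  have \<phi>: "\<phi> (\<alpha> x) = \<beta> x" if x: "x \<in> carrier M" for x
  proof -
    have "(SOME y. y \<in> carrier M \<and> \<alpha> y = \<alpha> x) \<in> carrier M \<and>
        \<alpha> (SOME y. y \<in> carrier M \<and> \<alpha> y = \<alpha> x) = \<alpha> x"
      by (rule someI[of _ x]) (simp add: x)
    thus ?thesis unfolding \<phi>_def using eq x by blast
  qed
  have ex: "\<exists>x\<in>carrier M. t = \<alpha> x" if "t \<in> carrier T" for t
    using that sa by blast
  have "\<phi> \<in> module_hom R T H"
  proof (rule module_homI)
    show "\<phi> t \<in> carrier H" if "t \<in> carrier T" for t using ex[OF that] \<phi> b by auto
    show "\<phi> (t \<oplus>\<^bsub>T\<^esub> u) = \<phi> t \<oplus>\<^bsub>H\<^esub> \<phi> u" if "t \<in> carrier T" "u \<in> carrier T" for t u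
      using ex[OF that(1)] ex[OF that(2)] \<phi> a(2) b(2) by (metis M.M.a_closed)
    show "\<phi> (r \<odot>\<^bsub>T\<^esub> t) = r \<odot>\<^bsub>H\<^esub> \<phi> t" if "r \<in> carrier R" "t \<in> carrier T" for r t
      using ex[OF that(2)] that(1) \<phi> a(3) b(3) by (metis M.smult_closed)
  qed
  moreover have "bij_betw \<phi> (carrier T) (carrier H)"
    unfolding bij_betw_def
  proof
    show "inj_on \<phi> (carrier T)"
    proof (rule inj_onI)
      fix t u assume tu: "t \<in> carrier T" "u \<in> carrier T" "\<phi> t = \<phi> u"
      then obtain x y where "x \<in> carrier M" "t = \<alpha> x" "y \<in> carrier M" "u = \<alpha> y" using ex by metis
      thus "t = u" using tu(3) eq \<phi> by simp
    qed
    have "\<phi> ` \<alpha> ` carrier M = \<beta> ` carrier M" unfolding image_image by (rule image_cong) (simp_all add: \<phi>)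
    thus "\<phi> ` carrier T = carrier H" by (simp only: sa sb)
  qed
  ultimately show ?thesis using \<phi> by (auto simp: module_iso_def)
qed

section \<open>Quotient modules\<close>

lemma submodule_imp_abelian_subgroup:
  assumes "module R M" "submodule N R M"
  shows "abelian_subgroup N M"
proof -
  interpret M: module R M by fact
  show ?thesis
    by (rule abelian_subgroupI3)
       (auto intro: additive_subgroup.intro submodule.axioms[OF assms(2)] M.M.abelian_group_axioms)
qed

lemma quotient_module_simps:
  "carrier (quotient_module M N) = a_rcosets\<^bsub>M\<^esub> N"
  "\<zero>\<^bsub>quotient_module M N\<^esub> = N"
  "A \<oplus>\<^bsub>quotient_module M N\<^esub> B = A <+>\<^bsub>M\<^esub> B"
  "r \<odot>\<^bsub>quotient_module M N\<^esub> A = (\<Union>x\<in>A. N +>\<^bsub>M\<^esub> (r \<odot>\<^bsub>M\<^esub> x))"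
  by (simp_all add: quotient_module_def)

context
  fixes R :: "('a, 'x) ring_scheme" and M :: "('a, 'm, 'y) module_scheme" and N :: "'m set"
  assumes M: "module R M" and N: "submodule N R M"
begin

interpretation M: module R M by (rule M)
interpretation N: abelian_subgroup N M by (rule submodule_imp_abelian_subgroup[OF M N])

lemma quotient_class_eq_iff:
  assumes "x \<in> carrier M" "y \<in> carrier M"
  shows "N +>\<^bsub>M\<^esub> x = N +>\<^bsub>M\<^esub> y \<longleftrightarrow> x \<ominus>\<^bsub>M\<^esub> y \<in> N"
proof -
  have "N +>\<^bsub>M\<^esub> x = N +>\<^bsub>M\<^esub> y \<longleftrightarrow> x \<in> N +>\<^bsub>M\<^esub> y"
    using N.a_rcos_self[OF assms(1)] N.a_repr_independence'[OF _ assms(2), of x] by auto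
  also have "\<dots> \<longleftrightarrow> x \<ominus>\<^bsub>M\<^esub> y \<in> N"
    using N.a_rcos_module[OF assms(2,1)] by (simp add: a_minus_def)
  finally show ?thesis .
qed

lemma quotient_class_eq_zero_iff:
  assumes "x \<in> carrier M"
  shows "N +>\<^bsub>M\<^esub> x = N \<longleftrightarrow> x \<in> N"
proof -
  have "\<ominus>\<^bsub>M\<^esub> \<zero>\<^bsub>M\<^esub> = \<zero>\<^bsub>M\<^esub>" by (rule M.M.minus_equality) simp_all
  thus ?thesis
    using quotient_class_eq_iff[OF assms M.M.zero_closed] assms N.a_subset
    by (simp add: M.M.minus_eq \<open>\<ominus>\<^bsub>M\<^esub> \<zero>\<^bsub>M\<^esub> = \<zero>\<^bsub>M\<^esub>\<close>)
qed

lemma quotient_smult_class: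
  assumes "r \<in> carrier R" "x \<in> carrier M"
  shows "r \<odot>\<^bsub>quotient_module M N\<^esub> (N +>\<^bsub>M\<^esub> x) = N +>\<^bsub>M\<^esub> (r \<odot>\<^bsub>M\<^esub> x)"
proof -
  have *: "N +>\<^bsub>M\<^esub> (r \<odot>\<^bsub>M\<^esub> y) = N +>\<^bsub>M\<^esub> (r \<odot>\<^bsub>M\<^esub> x)" if y: "y \<in> N +>\<^bsub>M\<^esub> x" for y
  proof -
    have yc: "y \<in> carrier M"
      by (rule subsetD[OF M.M.a_r_coset_subset_G[OF N.a_subset assms(2)] y])
    hence "y \<ominus>\<^bsub>M\<^esub> x \<in> N"
      using y N.a_rcos_module[OF assms(2) yc] by (simp add: a_minus_def)
    hence "r \<odot>\<^bsub>M\<^esub> (y \<ominus>\<^bsub>M\<^esub> x) \<in> N" using assms N by (simp add: submodule.smult_closed)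
    moreover have "r \<odot>\<^bsub>M\<^esub> (y \<ominus>\<^bsub>M\<^esub> x) = r \<odot>\<^bsub>M\<^esub> y \<ominus>\<^bsub>M\<^esub> r \<odot>\<^bsub>M\<^esub> x"
      using yc assms by (simp add: a_minus_def M.smult_r_distr M.smult_r_minus)
    ultimately show ?thesis using yc assms by (simp add: quotient_class_eq_iff)
  qed
  have "(\<Union>y\<in>N +>\<^bsub>M\<^esub> x. N +>\<^bsub>M\<^esub> (r \<odot>\<^bsub>M\<^esub> y)) = (\<Union>y\<in>N +>\<^bsub>M\<^esub> x. N +>\<^bsub>M\<^esub> (r \<odot>\<^bsub>M\<^esub> x))"
    by (rule SUP_cong[OF refl *])
  also have "\<dots> = N +>\<^bsub>M\<^esub> (r \<odot>\<^bsub>M\<^esub> x)"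
    using N.a_rcos_self[OF assms(2)] by (metis UN_constant empty_iff)
  finally show ?thesis by (simp only: quotient_module_simps)
qed

lemma quotient_class_surj:
  "(\<lambda>x. N +>\<^bsub>M\<^esub> x) ` carrier M = carrier (quotient_module M N)"
  unfolding quotient_module_simps A_RCOSETS_def' by blast

lemma quotient_class_hom: "(\<lambda>x. N +>\<^bsub>M\<^esub> x) \<in> module_hom R M (quotient_module M N)"
proof (rule module_homI)
  show "N +>\<^bsub>M\<^esub> x \<in> carrier (quotient_module M N)" if "x \<in> carrier M" for x
    using quotient_class_surj that by blast
  show "N +>\<^bsub>M\<^esub> (x \<oplus>\<^bsub>M\<^esub> y) = (N +>\<^bsub>M\<^esub> x) \<oplus>\<^bsub>quotient_module M N\<^esub> (N +>\<^bsub>M\<^esub> y)"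
    if "x \<in> carrier M" "y \<in> carrier M" for x y
    using that N.a_rcos_sum by (simp add: quotient_module_simps)
qed (simp add: quotient_smult_class)

lemma quotient_module_module: "module R (quotient_module M N)"
proof (rule moduleI)
  let ?Q = "quotient_module M N"
  note h = module_homD[OF quotient_class_hom]
  have ex: "\<exists>x\<in>carrier M. A = N +>\<^bsub>M\<^esub> x" if "A \<in> carrier ?Q" for A
    using that quotient_class_surj by blast
  show "cring R" by (rule M.R.cring_axioms)
  have zero: "\<zero>\<^bsub>?Q\<^esub> = N +>\<^bsub>M\<^esub> \<zero>\<^bsub>M\<^esub>"
    by (simp add: quotient_module_simps N.a_subset)
  note [simp] = h(2,3)[symmetric] h(1)
  show "abelian_group ?Q"
  proof (rule abelian_groupI)
    show "\<zero>\<^bsub>?Q\<^esub> \<in> carrier ?Q" unfolding zero by simp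
    fix A assume "A \<in> carrier ?Q"
    then obtain x where A: "x \<in> carrier M" "A = N +>\<^bsub>M\<^esub> x" using ex by metis
    show "\<zero>\<^bsub>?Q\<^esub> \<oplus>\<^bsub>?Q\<^esub> A = A" unfolding zero using A by simp
    show "\<exists>B\<in>carrier ?Q. B \<oplus>\<^bsub>?Q\<^esub> A = \<zero>\<^bsub>?Q\<^esub>"
      unfolding zero
      by (rule bexI[of _ "N +>\<^bsub>M\<^esub> (\<ominus>\<^bsub>M\<^esub> x)"]) (use A in \<open>simp_all add: M.M.l_neg\<close>)
    fix B assume "B \<in> carrier ?Q"
    then obtain y where B: "y \<in> carrier M" "B = N +>\<^bsub>M\<^esub> y" using ex by metis
    show "A \<oplus>\<^bsub>?Q\<^esub> B \<in> carrier ?Q" using A B by simp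
    show "A \<oplus>\<^bsub>?Q\<^esub> B = B \<oplus>\<^bsub>?Q\<^esub> A" using A B by (simp add: M.M.a_comm)
    fix C assume "C \<in> carrier ?Q"
    then obtain z where C: "z \<in> carrier M" "C = N +>\<^bsub>M\<^esub> z" using ex by metis
    show "A \<oplus>\<^bsub>?Q\<^esub> B \<oplus>\<^bsub>?Q\<^esub> C = A \<oplus>\<^bsub>?Q\<^esub> (B \<oplus>\<^bsub>?Q\<^esub> C)"
      using A B C by (simp add: M.M.a_assoc)
  qed
  fix A assume "A \<in> carrier ?Q"
  then obtain x where A: "x \<in> carrier M" "A = N +>\<^bsub>M\<^esub> x" using ex by metis
  show "\<one>\<^bsub>R\<^esub> \<odot>\<^bsub>?Q\<^esub> A = A" using A by simp
  fix a assume a: "a \<in> carrier R"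
  show "a \<odot>\<^bsub>?Q\<^esub> A \<in> carrier ?Q" using A a by simp
  show "a \<odot>\<^bsub>?Q\<^esub> (A \<oplus>\<^bsub>?Q\<^esub> B) = a \<odot>\<^bsub>?Q\<^esub> A \<oplus>\<^bsub>?Q\<^esub> a \<odot>\<^bsub>?Q\<^esub> B" if B: "B \<in> carrier ?Q" for B
  proof -
    obtain y where "y \<in> carrier M" "B = N +>\<^bsub>M\<^esub> y" using ex[OF B] by metis
    thus ?thesis using A a by (simp add: M.smult_r_distr)
  qed
  fix b assume b: "b \<in> carrier R"
  show "(a \<oplus>\<^bsub>R\<^esub> b) \<odot>\<^bsub>?Q\<^esub> A = a \<odot>\<^bsub>?Q\<^esub> A \<oplus>\<^bsub>?Q\<^esub> b \<odot>\<^bsub>?Q\<^esub> A"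
    using A a b by (simp add: M.smult_l_distr)
  show "a \<otimes>\<^bsub>R\<^esub> b \<odot>\<^bsub>?Q\<^esub> A = a \<odot>\<^bsub>?Q\<^esub> (b \<odot>\<^bsub>?Q\<^esub> A)"
    using A a b by (simp add: M.smult_assoc1)
qed

text \<open>A linear map that vanishes on \<open>N\<close> is constant on each coset, so its image of a coset is a singleton.\<close>

lemma the_elem_image_class:
  assumes P: "module R P" and L: "L \<in> module_hom R M P"
    and ker: "\<And>x. x \<in> N \<Longrightarrow> L x = \<zero>\<^bsub>P\<^esub>" and x: "x \<in> carrier M"
  shows "the_elem (L ` (N +>\<^bsub>M\<^esub> x)) = L x"
proof -
  interpret P: module R P by (rule P)
  have "L y = L x" if y: "y \<in> N +>\<^bsub>M\<^esub> x" for y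
  proof -
    obtain n where n: "n \<in> N" "y = n \<oplus>\<^bsub>M\<^esub> x" using y by (auto simp: a_r_coset_def')
    have "n \<in> carrier M" using n(1) N.a_subset by blast
    thus ?thesis by (simp add: n(2) module_homD[OF L] x ker[OF n(1)])
  qed
  hence "L ` (N +>\<^bsub>M\<^esub> x) = {L x}" using N.a_rcos_self[OF x] by (intro subset_antisym) blast+
  thus ?thesis by simp
qed

lemma quotient_factor_hom:
  assumes P: "module R P" and L: "L \<in> module_hom R M P"
    and ker: "\<And>x. x \<in> N \<Longrightarrow> L x = \<zero>\<^bsub>P\<^esub>"
  shows "(\<lambda>A. the_elem (L ` A)) \<in> module_hom R (quotient_module M N) P"
proof (rule module_homI)
  let ?Q = "quotient_module M N"
  note h = module_homD[OF quotient_class_hom] and l = module_homD[OF L]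
  note [simp] = h(2,3)[symmetric] h(1) the_elem_image_class[OF assms] l
  have ex: "\<exists>x\<in>carrier M. A = N +>\<^bsub>M\<^esub> x" if "A \<in> carrier ?Q" for A
    using that quotient_class_surj by blast
  fix r A B assume "A \<in> carrier ?Q"
  then obtain x where A: "x \<in> carrier M" "A = N +>\<^bsub>M\<^esub> x" using ex by metis
  thus "the_elem (L ` A) \<in> carrier P" by simp
  show "the_elem (L ` (r \<odot>\<^bsub>?Q\<^esub> A)) = r \<odot>\<^bsub>P\<^esub> the_elem (L ` A)" if "r \<in> carrier R"
    using A that by simp
  assume "B \<in> carrier ?Q"
  then obtain y where B: "y \<in> carrier M" "B = N +>\<^bsub>M\<^esub> y" using ex by metis
  show "the_elem (L ` (A \<oplus>\<^bsub>?Q\<^esub> B)) = the_elem (L ` A) \<oplus>\<^bsub>P\<^esub> the_elem (L ` B)"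
    using A B by simp
qed

end

section \<open>Free modules\<close>

lemma free_module_simps:
  "carrier (free_module R S) = {f. (\<forall>q\<in>S. f q \<in> carrier R) \<and> (\<forall>q. q \<notin> S \<longrightarrow> f q = \<zero>\<^bsub>R\<^esub>)
                  \<and> finite {q. f q \<noteq> \<zero>\<^bsub>R\<^esub>}}"
  "\<zero>\<^bsub>free_module R S\<^esub> = (\<lambda>q. \<zero>\<^bsub>R\<^esub>)"
  "f \<oplus>\<^bsub>free_module R S\<^esub> g = (\<lambda>q. f q \<oplus>\<^bsub>R\<^esub> g q)"
  "r \<odot>\<^bsub>free_module R S\<^esub> f = (\<lambda>q. r \<otimes>\<^bsub>R\<^esub> f q)"
  by (simp_all add: free_module_def)

text \<open>The linear extension to the free module of a map \<open>b\<close> given on generators.\<close>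

definition free_lift ::
  "[('a, 'x) ring_scheme, ('a, 'm, 'y) module_scheme, 's \<Rightarrow> 'm] \<Rightarrow> ('s \<Rightarrow> 'a) \<Rightarrow> 'm"
  where "free_lift R P b f = (\<Oplus>\<^bsub>P\<^esub>q\<in>{q. f q \<noteq> \<zero>\<^bsub>R\<^esub>}. f q \<odot>\<^bsub>P\<^esub> b q)"

context
  fixes R :: "('a, 'x) ring_scheme" and S :: "'s set"
  assumes R: "cring R"
begin

interpretation R: cring R by (rule R)

lemma free_module_closed:
  assumes "f \<in> carrier (free_module R S)"
  shows "f q \<in> carrier R"
  using assms by (cases "q \<in> S") (auto simp: free_module_simps)

lemma free_module_memI:
  assumes "\<And>q. q \<in> S \<Longrightarrow> f q \<in> carrier R" "\<And>q. q \<notin> S \<Longrightarrow> f q = \<zero>\<^bsub>R\<^esub>"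
    and "finite A" "\<And>q. q \<notin> A \<Longrightarrow> f q = \<zero>\<^bsub>R\<^esub>"
  shows "f \<in> carrier (free_module R S)"
proof -
  have "{q. f q \<noteq> \<zero>\<^bsub>R\<^esub>} \<subseteq> A" using assms(4) by blast
  hence "finite {q. f q \<noteq> \<zero>\<^bsub>R\<^esub>}" by (rule finite_subset[OF _ assms(3)])
  thus ?thesis using assms(1,2) by (simp add: free_module_simps)
qed

lemma free_module_memD:
  assumes "f \<in> carrier (free_module R S)"
  shows "q \<notin> S \<Longrightarrow> f q = \<zero>\<^bsub>R\<^esub>" "finite {q. f q \<noteq> \<zero>\<^bsub>R\<^esub>}" "{q. f q \<noteq> \<zero>\<^bsub>R\<^esub>} \<subseteq> S"
  using assms by (auto simp: free_module_simps)

lemma free_module_module: "module R (free_module R S)"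
proof (rule moduleI)
  let ?F = "free_module R S"
  show "cring R" by (rule R)
  have add: "f \<oplus>\<^bsub>?F\<^esub> g \<in> carrier ?F" if "f \<in> carrier ?F" "g \<in> carrier ?F" for f g
    using free_module_closed[OF that(1)] free_module_closed[OF that(2)]
      free_module_memD[OF that(1)] free_module_memD[OF that(2)]
    by (intro free_module_memI[where A = "{q. f q \<noteq> \<zero>\<^bsub>R\<^esub>} \<union> {q. g q \<noteq> \<zero>\<^bsub>R\<^esub>}"])
       (simp_all add: free_module_simps(3))
  have smult: "r \<odot>\<^bsub>?F\<^esub> f \<in> carrier ?F" if "r \<in> carrier R" "f \<in> carrier ?F" for r f
    using free_module_closed[OF that(2)] free_module_memD[OF that(2)] that(1)
    by (intro free_module_memI[where A = "{q. f q \<noteq> \<zero>\<^bsub>R\<^esub>}"]) (simp_all add: free_module_simps(4))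
  show "abelian_group ?F"
  proof (rule abelian_groupI)
    show "\<zero>\<^bsub>?F\<^esub> \<in> carrier ?F" by (simp add: free_module_simps)
    fix f assume f: "f \<in> carrier ?F"
    show "\<zero>\<^bsub>?F\<^esub> \<oplus>\<^bsub>?F\<^esub> f = f"
      using free_module_closed[OF f] by (simp add: free_module_simps)
    show "\<exists>g\<in>carrier ?F. g \<oplus>\<^bsub>?F\<^esub> f = \<zero>\<^bsub>?F\<^esub>"
    proof
      show "(\<ominus>\<^bsub>R\<^esub> \<one>\<^bsub>R\<^esub>) \<odot>\<^bsub>?F\<^esub> f \<in> carrier ?F" by (rule smult[OF _ f]) simp
      show "(\<ominus>\<^bsub>R\<^esub> \<one>\<^bsub>R\<^esub>) \<odot>\<^bsub>?F\<^esub> f \<oplus>\<^bsub>?F\<^esub> f = \<zero>\<^bsub>?F\<^esub>"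
        using free_module_closed[OF f] by (simp add: free_module_simps R.l_minus R.l_neg)
    qed
    fix g assume g: "g \<in> carrier ?F"
    show "f \<oplus>\<^bsub>?F\<^esub> g \<in> carrier ?F" by (rule add[OF f g])
    show "f \<oplus>\<^bsub>?F\<^esub> g = g \<oplus>\<^bsub>?F\<^esub> f"
      using free_module_closed[OF f] free_module_closed[OF g]
      by (simp add: free_module_simps R.a_comm)
    fix h assume h: "h \<in> carrier ?F"
    show "f \<oplus>\<^bsub>?F\<^esub> g \<oplus>\<^bsub>?F\<^esub> h = f \<oplus>\<^bsub>?F\<^esub> (g \<oplus>\<^bsub>?F\<^esub> h)"
      using free_module_closed[OF f] free_module_closed[OF g] free_module_closed[OF h]
      by (simp add: free_module_simps R.a_assoc)
  qed
  fix f assume f: "f \<in> carrier ?F"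
  note [simp] = free_module_closed[OF f]
  show "\<one>\<^bsub>R\<^esub> \<odot>\<^bsub>?F\<^esub> f = f" by (simp add: free_module_simps)
  fix a assume a: "a \<in> carrier R"
  show "a \<odot>\<^bsub>?F\<^esub> f \<in> carrier ?F" by (rule smult[OF a f])
  show "a \<odot>\<^bsub>?F\<^esub> (f \<oplus>\<^bsub>?F\<^esub> g) = a \<odot>\<^bsub>?F\<^esub> f \<oplus>\<^bsub>?F\<^esub> a \<odot>\<^bsub>?F\<^esub> g" if g: "g \<in> carrier ?F" for g
    using free_module_closed[OF g] a by (simp add: free_module_simps R.r_distr)
  fix b assume b: "b \<in> carrier R"
  show "(a \<oplus>\<^bsub>R\<^esub> b) \<odot>\<^bsub>?F\<^esub> f = a \<odot>\<^bsub>?F\<^esub> f \<oplus>\<^bsub>?F\<^esub> b \<odot>\<^bsub>?F\<^esub> f"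
    using a b by (simp add: free_module_simps R.l_distr)
  show "a \<otimes>\<^bsub>R\<^esub> b \<odot>\<^bsub>?F\<^esub> f = a \<odot>\<^bsub>?F\<^esub> (b \<odot>\<^bsub>?F\<^esub> f)"
    using a b by (simp add: free_module_simps R.m_assoc)
qed

lemma free_gen_closed: "q \<in> S \<Longrightarrow> free_gen R q \<in> carrier (free_module R S)"
  by (auto simp: free_module_simps free_gen_def)

text \<open>Induction over the support: a finitely supported function is a combination of generators,
peeled off one point at a time.\<close>

lemma free_module_generated:
  assumes H: "submodule H R (free_module R S)"
    and gen: "\<And>q. q \<in> S \<Longrightarrow> free_gen R q \<in> H"
  shows "H = carrier (free_module R S)"
proof -
  let ?F = "free_module R S"
  interpret F: module R ?F by (rule free_module_module)
  note h = F.submoduleE[OF H]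
  have "f \<in> H" if "finite A" "f \<in> carrier ?F" "{q. f q \<noteq> \<zero>\<^bsub>R\<^esub>} \<subseteq> A" for A f
    using that
  proof (induction A arbitrary: f rule: finite_induct)
    case empty
    hence "f = \<zero>\<^bsub>?F\<^esub>" by (auto simp: free_module_simps)
    also have "\<dots> \<in> H" using submodule.axioms(1)[OF H] subgroup.one_closed by force
    finally show ?case .
  next
    case (insert a A)
    show ?case
    proof (cases "f a = \<zero>\<^bsub>R\<^esub>")
      case True
      thus ?thesis using insert by blast
    next
      case False
      hence aS: "a \<in> S" using insert.prems by (auto simp: free_module_simps)
      let ?f = "f(a := \<zero>\<^bsub>R\<^esub>)"
      have sub: "{q. ?f q \<noteq> \<zero>\<^bsub>R\<^esub>} \<subseteq> A" using insert.prems by auto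
      hence fc: "?f \<in> carrier ?F"
        using free_module_closed[OF insert.prems(1)] free_module_memD(1)[OF insert.prems(1)] insert.hyps insert.prems(2)
        by (intro free_module_memI[where A = A]) auto
      have "?f \<oplus>\<^bsub>?F\<^esub> f a \<odot>\<^bsub>?F\<^esub> free_gen R a \<in> H"

        by (intro h(4,5) insert.IH[OF fc sub] gen[OF aS] free_module_closed[OF insert.prems(1)])
      moreover have "?f \<oplus>\<^bsub>?F\<^esub> f a \<odot>\<^bsub>?F\<^esub> free_gen R a = f"
        using free_module_closed[OF insert.prems(1)]
        by (auto simp: free_module_simps free_gen_def)
      ultimately show ?thesis by simp
    qed
  qed
  hence "f \<in> H" if "f \<in> carrier ?F" for f
    using free_module_memD(2)[OF that] that by blast
  thus ?thesis using h(1) by blast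
qed

context
  fixes P :: "('a, 'm, 'y) module_scheme" and b :: "'s \<Rightarrow> 'm"
  assumes P: "module R P" and b: "\<And>q. q \<in> S \<Longrightarrow> b q \<in> carrier P"
begin

interpretation P: module R P by (rule P)

text \<open>The sum may run over any finite set containing the support. Additivity needs this freedom, because
two functions and their sum have different supports.\<close>

lemma free_lift_eq_finsum:
  assumes f: "f \<in> carrier (free_module R S)" and A: "finite A" "A \<subseteq> S" "{q. f q \<noteq> \<zero>\<^bsub>R\<^esub>} \<subseteq> A"
  shows "free_lift R P b f = (\<Oplus>\<^bsub>P\<^esub>q\<in>A. f q \<odot>\<^bsub>P\<^esub> b q)"
  unfolding free_lift_def
proof (rule P.M.add.finprod_mono_neutral_cong_left)
  show "f q \<odot>\<^bsub>P\<^esub> b q = \<zero>\<^bsub>P\<^esub>" if "q \<in> A - {q. f q \<noteq> \<zero>\<^bsub>R\<^esub>}" for q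
    using that A b by auto
  show "(\<lambda>q. f q \<odot>\<^bsub>P\<^esub> b q) \<in> A \<rightarrow> carrier P"
    using A b free_module_closed[OF f] by auto
qed (use A in auto)

lemma free_lift_hom: "free_lift R P b \<in> module_hom R (free_module R S) P"
proof (rule module_homI)
  let ?F = "free_module R S"
  interpret F: module R ?F by (rule free_module_module)
  note [simp] = free_module_closed
  have in_P: "(\<lambda>q. f q \<odot>\<^bsub>P\<^esub> b q) \<in> A \<rightarrow> carrier P" if "f \<in> carrier ?F" "A \<subseteq> S" for f A
    using that b by auto
  fix f assume f: "f \<in> carrier ?F"
  show "free_lift R P b f \<in> carrier P"
    unfolding free_lift_def by (rule P.M.finsum_closed, rule in_P[OF f free_module_memD(3)[OF f]])
  show "free_lift R P b (r \<odot>\<^bsub>?F\<^esub> f) = r \<odot>\<^bsub>P\<^esub> free_lift R P b f" if r: "r \<in> carrier R" for r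
  proof -
    let ?A = "{q. f q \<noteq> \<zero>\<^bsub>R\<^esub>}"
    note s = free_module_memD(2,3)[OF f]
    have "free_lift R P b (r \<odot>\<^bsub>?F\<^esub> f) = (\<Oplus>\<^bsub>P\<^esub>q\<in>?A. (r \<odot>\<^bsub>?F\<^esub> f) q \<odot>\<^bsub>P\<^esub> b q)"
      using r by (intro free_lift_eq_finsum F.smult_closed f s) (auto simp: free_module_simps(4))
    also have "\<dots> = (\<Oplus>\<^bsub>P\<^esub>q\<in>?A. r \<odot>\<^bsub>P\<^esub> (f q \<odot>\<^bsub>P\<^esub> b q))"
    proof (rule P.M.finsum_cong')
      fix q assume "q \<in> ?A"
      hence "b q \<in> carrier P" using s b by blast
      thus "(r \<odot>\<^bsub>?F\<^esub> f) q \<odot>\<^bsub>P\<^esub> b q = r \<odot>\<^bsub>P\<^esub> (f q \<odot>\<^bsub>P\<^esub> b q)"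
        using f r by (simp add: free_module_simps(4) P.smult_assoc1)
    qed (use in_P[OF f s(2)] r in auto)
    also have "\<dots> = r \<odot>\<^bsub>P\<^esub> free_lift R P b f"
      unfolding free_lift_def
      by (rule P.finsum_smult_ldistr[symmetric, OF s(1) r in_P[OF f s(2)]])
    finally show ?thesis .
  qed
  fix g assume g: "g \<in> carrier ?F"
  show "free_lift R P b (f \<oplus>\<^bsub>?F\<^esub> g) = free_lift R P b f \<oplus>\<^bsub>P\<^esub> free_lift R P b g"
  proof -
    let ?A = "{q. f q \<noteq> \<zero>\<^bsub>R\<^esub>} \<union> {q. g q \<noteq> \<zero>\<^bsub>R\<^esub>}"
    have A: "finite ?A" "?A \<subseteq> S"
      using free_module_memD(2,3)[OF f] free_module_memD(2,3)[OF g] by auto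
    have "free_lift R P b (f \<oplus>\<^bsub>?F\<^esub> g) = (\<Oplus>\<^bsub>P\<^esub>q\<in>?A. (f \<oplus>\<^bsub>?F\<^esub> g) q \<odot>\<^bsub>P\<^esub> b q)"
      by (intro free_lift_eq_finsum F.M.a_closed f g A) (auto simp: free_module_simps(3))
    also have "\<dots> = (\<Oplus>\<^bsub>P\<^esub>q\<in>?A. f q \<odot>\<^bsub>P\<^esub> b q \<oplus>\<^bsub>P\<^esub> g q \<odot>\<^bsub>P\<^esub> b q)"
    proof (rule P.M.finsum_cong')
      fix q assume "q \<in> ?A"
      hence "b q \<in> carrier P" using A b by blast
      thus "(f \<oplus>\<^bsub>?F\<^esub> g) q \<odot>\<^bsub>P\<^esub> b q = f q \<odot>\<^bsub>P\<^esub> b q \<oplus>\<^bsub>P\<^esub> g q \<odot>\<^bsub>P\<^esub> b q"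
        using f g by (simp add: free_module_simps(3) P.smult_l_distr)
    qed (use in_P[OF f A(2)] in_P[OF g A(2)] in \<open>auto simp: Pi_iff\<close>)
    also have "\<dots> = (\<Oplus>\<^bsub>P\<^esub>q\<in>?A. f q \<odot>\<^bsub>P\<^esub> b q) \<oplus>\<^bsub>P\<^esub> (\<Oplus>\<^bsub>P\<^esub>q\<in>?A. g q \<odot>\<^bsub>P\<^esub> b q)"
      by (rule P.M.finsum_addf[OF in_P[OF f A(2)] in_P[OF g A(2)]])
    also have "\<dots> = free_lift R P b f \<oplus>\<^bsub>P\<^esub> free_lift R P b g"
      using free_lift_eq_finsum[OF f A] free_lift_eq_finsum[OF g A] by simp
    finally show ?thesis .
  qed
qed

lemma free_lift_gen:
  assumes "q \<in> S"
  shows "free_lift R P b (free_gen R q) = b q"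
proof -
  have "free_lift R P b (free_gen R q) = (\<Oplus>\<^bsub>P\<^esub>q'\<in>{q}. free_gen R q q' \<odot>\<^bsub>P\<^esub> b q')"
    by (rule free_lift_eq_finsum[OF free_gen_closed[OF assms]])
       (use assms in \<open>auto simp: free_gen_def split: if_splits\<close>)
  also have "\<dots> = b q"
    using b[OF assms] by (simp add: free_gen_def)
  finally show ?thesis .
qed

end

end

section \<open>Tensor products\<close>

lemma generated_submodule_submodule:
  assumes M: "module R M" and X: "X \<subseteq> carrier M"
  shows "submodule (generated_submodule R M X) R M"
proof -
  interpret M: module R M by (rule M)
  let ?\<H> = "{H. submodule H R M \<and> X \<subseteq> H}"
  have c: "carrier M \<in> ?\<H>" using M.carrier_is_submodule X by simp
  note h = M.submoduleE
  have z: "\<zero>\<^bsub>M\<^esub> \<in> H" if "submodule H R M" for H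
    using submodule.axioms(1)[OF that] subgroup.one_closed by force
  show ?thesis unfolding generated_submodule_def
  proof (rule M.submoduleI)
    show "\<Inter>?\<H> \<subseteq> carrier M" by (rule Inter_lower[OF c])
    show "\<zero>\<^bsub>M\<^esub> \<in> \<Inter>?\<H>" by (rule InterI) (simp add: z)
  qed (rule InterI, simp add: h)+
qed

lemma generated_submodule_superset: "X \<subseteq> generated_submodule R M X"
  by (auto simp: generated_submodule_def)

lemma generated_submodule_minimal:
  "submodule H R M \<Longrightarrow> X \<subseteq> H \<Longrightarrow> generated_submodule R M X \<subseteq> H"
  by (auto simp: generated_submodule_def)

definition bilinear_map ::
  "[('a, 'x) ring_scheme, ('a, 'm, 'y) module_scheme, ('a, 'n, 'z) module_scheme,
    ('a, 'p, 'w) module_scheme] \<Rightarrow> ('m \<Rightarrow> 'n \<Rightarrow> 'p) set"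
  where "bilinear_map R M N P =
    {b. (\<forall>n\<in>carrier N. (\<lambda>m. b m n) \<in> module_hom R M P) \<and>
        (\<forall>m\<in>carrier M. b m \<in> module_hom R N P)}"

lemma bilinear_mapD:
  assumes "b \<in> bilinear_map R M N P"
  shows "n \<in> carrier N \<Longrightarrow> (\<lambda>m. b m n) \<in> module_hom R M P"
    and "m \<in> carrier M \<Longrightarrow> b m \<in> module_hom R N P"
  using assms by (simp_all add: bilinear_map_def)

context
  fixes R :: "('a, 'x) ring_scheme" and M :: "('a, 'm, 'y) module_scheme"
    and N :: "('a, 'n, 'z) module_scheme"
  assumes M: "module R M" and N: "module R N"
begin

interpretation M: module R M by (rule M)
interpretation N: module R N by (rule N)

private abbreviation (input) F where "F \<equiv> free_module R (carrier M \<times> carrier N)"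

interpretation F: module R F by (rule free_module_module[OF M.R.cring_axioms])

lemma tensor_relations_closed: "tensor_relations R M N \<subseteq> carrier F"
proof -
  have [simp]: "free_gen R (m, n) \<in> carrier F" if "m \<in> carrier M" "n \<in> carrier N" for m n
    using that by (simp add: free_gen_closed[OF M.R.cring_axioms])
  show ?thesis
    unfolding tensor_relations_def Let_def
    by (intro Un_least subsetI; elim CollectE exE conjE; simp)
qed

lemma tensor_kernel_submodule: "submodule (tensor_kernel R M N) R F"
  unfolding tensor_kernel_def
  by (rule generated_submodule_submodule[OF F.module_axioms tensor_relations_closed])

lemma tensor_product_module: "module R (tensor_product R M N)"
  unfolding tensor_product_def
  by (rule quotient_module_module[OF F.module_axioms tensor_kernel_submodule])

lemma pure_tensor_closed:
  assumes "m \<in> carrier M" "n \<in> carrier N"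
  shows "pure_tensor R M N m n \<in> carrier (tensor_product R M N)"
  unfolding pure_tensor_def tensor_product_def
  by (rule module_homD(1)[OF quotient_class_hom[OF F.module_axioms tensor_kernel_submodule]])
     (use assms in \<open>simp add: free_gen_closed[OF M.R.cring_axioms]\<close>)

lemma pure_tensor_bilinear: "pure_tensor R M N \<in> bilinear_map R M N (tensor_product R M N)"
proof -
  let ?K = "tensor_kernel R M N" and ?T = "tensor_product R M N"
  let ?e = "\<lambda>m n. free_gen R (m, n)" and ?c = "\<lambda>f. tensor_kernel R M N +>\<^bsub>F\<^esub> f"
  note sm = F.module_axioms tensor_kernel_submodule
  note h = module_homD[OF quotient_class_hom[OF sm], folded tensor_product_def]
  have e: "?e m n \<in> carrier F" if "m \<in> carrier M" "n \<in> carrier N" for m n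
    using that by (simp add: free_gen_closed[OF M.R.cring_axioms])
  have p: "pure_tensor R M N m n = ?c (?e m n)" for m n by (simp add: pure_tensor_def)
  have eq: "?c x = ?c y" if "x \<ominus>\<^bsub>F\<^esub> y \<in> tensor_relations R M N" "x \<in> carrier F" "y \<in> carrier F" for x y
    using that generated_submodule_superset[of "tensor_relations R M N" R F]
    by (subst quotient_class_eq_iff[OF sm]) (auto simp: tensor_kernel_def)
  note rel = tensor_relations_def[of R M N, unfolded Let_def]
  show ?thesis unfolding bilinear_map_def
  proof (intro CollectI conjI ballI module_homI)
    fix m n assume mn: "m \<in> carrier M" "n \<in> carrier N"
    show "pure_tensor R M N m n \<in> carrier ?T" "pure_tensor R M N m n \<in> carrier ?T"
      using pure_tensor_closed mn by auto
    show "pure_tensor R M N (m \<oplus>\<^bsub>M\<^esub> m') n = pure_tensor R M N m n \<oplus>\<^bsub>?T\<^esub> pure_tensor R M N m' n"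
      if "m' \<in> carrier M" for m'
    proof -
      have "?c (?e (m \<oplus>\<^bsub>M\<^esub> m') n) = ?c (?e m n \<oplus>\<^bsub>F\<^esub> ?e m' n)"
        by (rule eq) (use mn that e in \<open>simp_all add: rel, blast?\<close>)
      thus ?thesis using mn that by (simp add: p h e)
    qed
    show "pure_tensor R M N m (n \<oplus>\<^bsub>N\<^esub> n') = pure_tensor R M N m n \<oplus>\<^bsub>?T\<^esub> pure_tensor R M N m n'"
      if "n' \<in> carrier N" for n'
    proof -
      have "?c (?e m (n \<oplus>\<^bsub>N\<^esub> n')) = ?c (?e m n \<oplus>\<^bsub>F\<^esub> ?e m n')"
        by (rule eq) (use mn that e in \<open>simp_all add: rel, blast?\<close>)
      thus ?thesis using mn that by (simp add: p h e)
    qed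
    fix r assume r: "r \<in> carrier R"
    have "?c (?e (r \<odot>\<^bsub>M\<^esub> m) n) = ?c (r \<odot>\<^bsub>F\<^esub> ?e m n)"
      by (rule eq) (use mn r e in \<open>simp_all add: rel, blast?\<close>)
    thus "pure_tensor R M N (r \<odot>\<^bsub>M\<^esub> m) n = r \<odot>\<^bsub>?T\<^esub> pure_tensor R M N m n"
      using mn r by (simp add: p h e)
    have "?c (?e m (r \<odot>\<^bsub>N\<^esub> n)) = ?c (r \<odot>\<^bsub>F\<^esub> ?e m n)"
      by (rule eq) (use mn r e in \<open>simp_all add: rel, blast?\<close>)
    thus "pure_tensor R M N m (r \<odot>\<^bsub>N\<^esub> n) = r \<odot>\<^bsub>?T\<^esub> pure_tensor R M N m n"
      using mn r by (simp add: p h e)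
  qed
qed

text \<open>The elements of the free module whose class lies in \<open>H\<close> form a submodule containing all generators.\<close>

lemma tensor_product_generated:
  assumes H: "submodule H R (tensor_product R M N)"
    and gen: "\<And>m n. m \<in> carrier M \<Longrightarrow> n \<in> carrier N \<Longrightarrow> pure_tensor R M N m n \<in> H"
  shows "H = carrier (tensor_product R M N)"
proof -
  let ?T = "tensor_product R M N" and ?c = "\<lambda>f. tensor_kernel R M N +>\<^bsub>F\<^esub> f"
  note sm = F.module_axioms tensor_kernel_submodule
  interpret T: module R ?T by (rule tensor_product_module)
  have "{f \<in> carrier F. ?c f \<in> H} = carrier F"
  proof (rule free_module_generated[OF M.R.cring_axioms])
    show "submodule {f \<in> carrier F. ?c f \<in> H} R F"
      by (rule submodule_vimage[OF F.module_axioms tensor_product_module _ H])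
         (unfold tensor_product_def, rule quotient_class_hom[OF sm])
    show "free_gen R q \<in> {f \<in> carrier F. ?c f \<in> H}" if "q \<in> carrier M \<times> carrier N" for q
      using that gen free_gen_closed[OF M.R.cring_axioms that] by (auto simp: pure_tensor_def)
  qed
  hence "?c ` carrier F \<subseteq> H" by blast
  hence "carrier ?T \<subseteq> H"
    unfolding tensor_product_def quotient_class_surj[OF sm] .
  thus ?thesis using T.submoduleE(1)[OF H] by blast
qed

context
  fixes P :: "('a, 'p, 'w) module_scheme" and b :: "'m \<Rightarrow> 'n \<Rightarrow> 'p"
  assumes P: "module R P" and b: "b \<in> bilinear_map R M N P"
begin

interpretation P: module R P by (rule P)

lemma bilinear_closed: "q \<in> carrier M \<times> carrier N \<Longrightarrow> b (fst q) (snd q) \<in> carrier P"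
  using module_homD(1)[OF bilinear_mapD(2)[OF b]] by (simp add: mem_Times_iff)

lemma bilinear_free_lift_hom: "free_lift R P (\<lambda>q. b (fst q) (snd q)) \<in> module_hom R F P"
  by (rule free_lift_hom[OF M.R.cring_axioms P bilinear_closed])

lemma bilinear_free_lift_gen:
  assumes "m \<in> carrier M" "n \<in> carrier N"
  shows "free_lift R P (\<lambda>q. b (fst q) (snd q)) (free_gen R (m, n)) = b m n"
  using free_lift_gen[where q = "(m, n)", OF M.R.cring_axioms P bilinear_closed] assms by simp

text \<open>Bilinearity says precisely that the linear extension of \<open>b\<close> kills each defining relation, and the
kernel of a linear map is a submodule, so it contains everything that the relations generate.\<close>

lemma tensor_kernel_lift_zero:
  assumes "f \<in> tensor_kernel R M N"
  shows "free_lift R P (\<lambda>q. b (fst q) (snd q)) f = \<zero>\<^bsub>P\<^esub>"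
proof -
  let ?L = "free_lift R P (\<lambda>q. b (fst q) (snd q))"
  note L = bilinear_free_lift_hom
  note g = bilinear_free_lift_gen
  have e: "free_gen R (m, n) \<in> carrier F" if "m \<in> carrier M" "n \<in> carrier N" for m n
    using that by (simp add: free_gen_closed[OF M.R.cring_axioms])
  note b1 = bilinear_mapD(1)[OF b] and b2 = bilinear_mapD(2)[OF b]
  have eq: "?L (x \<ominus>\<^bsub>F\<^esub> y) = \<zero>\<^bsub>P\<^esub>" if "x \<in> carrier F" "y \<in> carrier F" "?L x = ?L y" for x y
    using that module_homD(1)[OF L]

    by (simp only: module_hom_minus[OF F.module_axioms P L] module_minus_zero_iff[OF P])
  have "tensor_relations R M N \<subseteq> {f \<in> carrier F. ?L f = \<zero>\<^bsub>P\<^esub>}"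
  proof
    fix f assume f: "f \<in> tensor_relations R M N"
    hence "f \<in> carrier F" using tensor_relations_closed by blast
    moreover have "?L f = \<zero>\<^bsub>P\<^esub>"
      using f unfolding tensor_relations_def Let_def
      by (elim UnE CollectE exE conjE; hypsubst; intro eq)
         (simp_all add: e g module_homD[OF L] module_homD[OF b1] module_homD[OF b2])
    ultimately show "f \<in> {f \<in> carrier F. ?L f = \<zero>\<^bsub>P\<^esub>}" by simp
  qed
  hence "tensor_kernel R M N \<subseteq> {f \<in> carrier F. ?L f = \<zero>\<^bsub>P\<^esub>}"
    unfolding tensor_kernel_def
    by (intro generated_submodule_minimal submodule_kernel[OF F.module_axioms P L])
  thus ?thesis using assms by blast
qed

lemma tensor_lift_hom:
  "(\<lambda>A. the_elem (free_lift R P (\<lambda>q. b (fst q) (snd q)) ` A)) \<in> module_hom R (tensor_product R M N) P"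
  unfolding tensor_product_def
  by (rule quotient_factor_hom[OF F.module_axioms tensor_kernel_submodule P
        bilinear_free_lift_hom tensor_kernel_lift_zero])

lemma tensor_lift_pure:
  assumes "m \<in> carrier M" "n \<in> carrier N"
  shows "the_elem (free_lift R P (\<lambda>q. b (fst q) (snd q)) ` pure_tensor R M N m n) = b m n"
proof -
  have "free_gen R (m, n) \<in> carrier F"
    using assms by (simp add: free_gen_closed[OF M.R.cring_axioms])
  thus ?thesis
    unfolding pure_tensor_def
    by (simp add: the_elem_image_class[OF F.module_axioms tensor_kernel_submodule P
          bilinear_free_lift_hom tensor_kernel_lift_zero] bilinear_free_lift_gen assms)
qed

end

end

text \<open>The map induced by \<open>g\<close> and \<open>h\<close> is the one that the universal property attaches to the bilinear map
\<open>(m, n) \<mapsto> g m \<otimes> h n\<close>. Its linearity and its values on pure tensors follow from this.\<close>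

lemma tensor_map_eq:
  "tensor_map R M' N' g h A =
    the_elem (free_lift R (tensor_product R M' N') (\<lambda>q. pure_tensor R M' N' (g (fst q)) (h (snd q))) ` A)"
  by (simp add: tensor_map_def free_lift_def)

lemma bilinear_map_compose:
  assumes b: "b \<in> bilinear_map R M' N' P"
    and g: "g \<in> module_hom R M M'" and h: "h \<in> module_hom R N N'"
  shows "(\<lambda>m n. b (g m) (h n)) \<in> bilinear_map R M N P"
proof -
  have "(\<lambda>m. b (g m) (h n)) \<in> module_hom R M P" if "n \<in> carrier N" for n
    by (rule module_hom_compose[OF g bilinear_mapD(1)[OF b module_homD(1)[OF h that]]])
  moreover have "(\<lambda>n. b (g m) (h n)) \<in> module_hom R N P" if "m \<in> carrier M" for m
    by (rule module_hom_compose[OF h bilinear_mapD(2)[OF b module_homD(1)[OF g that]]])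
  ultimately show ?thesis by (simp add: bilinear_map_def)
qed

lemma tensor_map_hom:
  assumes "module R M" "module R N" "module R M'" "module R N'"
    and "g \<in> module_hom R M M'" "h \<in> module_hom R N N'"
  shows "tensor_map R M' N' g h \<in> module_hom R (tensor_product R M N) (tensor_product R M' N')"
  unfolding tensor_map_eq[abs_def]
  by (rule tensor_lift_hom[OF assms(1,2) tensor_product_module[OF assms(3,4)]
        bilinear_map_compose[OF pure_tensor_bilinear[OF assms(3,4)] assms(5,6)]])

lemma tensor_map_pure:
  assumes "module R M" "module R N" "module R M'" "module R N'"
    and "g \<in> module_hom R M M'" "h \<in> module_hom R N N'" "m \<in> carrier M" "n \<in> carrier N"
  shows "tensor_map R M' N' g h (pure_tensor R M N m n) = pure_tensor R M' N' (g m) (h n)"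
  unfolding tensor_map_eq
  by (rule tensor_lift_pure[OF assms(1,2) tensor_product_module[OF assms(3,4)]
        bilinear_map_compose[OF pure_tensor_bilinear[OF assms(3,4)] assms(5,6)] assms(7,8)])

section \<open>Reduction modulo a principal ideal\<close>

lemma (in abelian_group) minus_eq_iff:
  assumes "x \<in> carrier G" "y \<in> carrier G" "z \<in> carrier G"
  shows "x \<ominus> y = z \<longleftrightarrow> x = y \<oplus> z"
  using add.inv_solve_right[of z x y] a_comm[of z y] assms by (auto simp: a_minus_def)

lemma (in cring) cgenideal_mem_iff:
  assumes "a \<in> carrier R"
  shows "x \<in> PIdl a \<longleftrightarrow> (\<exists>y\<in>carrier R. x = a \<otimes> y)"
  unfolding cgenideal_def using m_comm[OF assms] by fastforce

lemma quotient_ring_module_simps: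
  "carrier (quotient_ring_module R I) = carrier (R Quot I)"
  "\<one>\<^bsub>quotient_ring_module R I\<^esub> = \<one>\<^bsub>R Quot I\<^esub>"
  "\<zero>\<^bsub>quotient_ring_module R I\<^esub> = \<zero>\<^bsub>R Quot I\<^esub>"
  "A \<oplus>\<^bsub>quotient_ring_module R I\<^esub> B = A \<oplus>\<^bsub>R Quot I\<^esub> B"
  "r \<odot>\<^bsub>quotient_ring_module R I\<^esub> A = (I +>\<^bsub>R\<^esub> r) \<otimes>\<^bsub>R Quot I\<^esub> A"
  by (simp_all add: quotient_ring_module_def)

lemma quotient_ring_module_module:
  assumes R: "cring R" and I: "ideal I R"
  shows "module R (quotient_ring_module R I)"
proof -
  let ?Q = "quotient_ring_module R I"
  interpret R: cring R by (rule R)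
  interpret Q: cring "R Quot I" by (rule ideal.quotient_is_cring[OF I R])
  note hom = ideal.rcos_ring_hom[OF I]
  note h = ring_hom_closed[OF hom] ring_hom_add[OF hom] ring_hom_mult[OF hom] ring_hom_one[OF hom]
  show ?thesis
  proof (rule moduleI)
    show "cring R" by (rule R)
    show "abelian_group ?Q"
    proof (rule abelian_groupI)
      show "\<exists>B\<in>carrier ?Q. B \<oplus>\<^bsub>?Q\<^esub> A = \<zero>\<^bsub>?Q\<^esub>" if "A \<in> carrier ?Q" for A
        by (rule bexI[of _ "\<ominus>\<^bsub>R Quot I\<^esub> A"])
           (use that in \<open>simp_all add: quotient_ring_module_simps Q.l_neg\<close>)
    qed (simp_all add: quotient_ring_module_simps Q.a_ac)
  qed (simp_all add: quotient_ring_module_simps h Q.l_distr Q.r_distr Q.m_assoc)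
qed

context
  fixes R :: "('a, 'x) ring_scheme" and M :: "('a, 'm, 'y) module_scheme" and a :: 'a
  assumes M: "module R M" and a: "a \<in> carrier R"
begin

interpretation M: module R M by (rule M)
interpretation I: ideal "PIdl\<^bsub>R\<^esub> a" R by (rule M.R.cgenideal_ideal[OF a])

private abbreviation (input) I where "I \<equiv> PIdl\<^bsub>R\<^esub> a"
private abbreviation (input) Q where "Q \<equiv> quotient_ring_module R (PIdl\<^bsub>R\<^esub> a)"
private abbreviation (input) T where "T \<equiv> tensor_product R M (quotient_ring_module R (PIdl\<^bsub>R\<^esub> a))"
private abbreviation (input) aM where "aM \<equiv> (\<lambda>m. a \<odot>\<^bsub>M\<^esub> m) ` carrier M"

interpretation Q: module R Q by (rule quotient_ring_module_module[OF M.R.cring_axioms I.ideal_axioms])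
interpretation T: module R T by (rule tensor_product_module[OF M Q.module_axioms])

lemma smult_hom: "r \<in> carrier R \<Longrightarrow> (\<lambda>m. r \<odot>\<^bsub>M\<^esub> m) \<in> module_hom R M M"
proof (rule module_homI)
  fix t x assume r: "r \<in> carrier R" and "t \<in> carrier R" "x \<in> carrier M"
  thus "r \<odot>\<^bsub>M\<^esub> (t \<odot>\<^bsub>M\<^esub> x) = t \<odot>\<^bsub>M\<^esub> (r \<odot>\<^bsub>M\<^esub> x)"
    using M.smult_assoc1[of r t x] M.smult_assoc1[of t r x] M.R.m_comm[of r t] by simp
qed (simp_all add: M.smult_r_distr)

lemma multiples_submodule: "submodule aM R M"
  by (rule submodule_image[OF M M smult_hom[OF a]])

lemma one_quotient_ring_module: "\<one>\<^bsub>Q\<^esub> = I +>\<^bsub>R\<^esub> \<one>\<^bsub>R\<^esub>"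
  by (simp only: quotient_ring_module_simps FactRing_def monoid.simps)

lemma class_quotient_ring_module:
  assumes "r \<in> carrier R"
  shows "I +>\<^bsub>R\<^esub> r \<in> carrier Q" and "I +>\<^bsub>R\<^esub> r = r \<odot>\<^bsub>Q\<^esub> \<one>\<^bsub>Q\<^esub>"
proof -
  note hom = I.rcos_ring_hom
  show "I +>\<^bsub>R\<^esub> r \<in> carrier Q"
    using ring_hom_closed[OF hom assms] by (simp add: quotient_ring_module_simps)
  show "I +>\<^bsub>R\<^esub> r = r \<odot>\<^bsub>Q\<^esub> \<one>\<^bsub>Q\<^esub>"
    using ring_hom_mult[OF hom assms M.R.one_closed] assms
    by (simp add: one_quotient_ring_module) (simp add: quotient_ring_module_simps)
qed

lemma quotient_ring_module_ex:
  assumes "A \<in> carrier Q"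
  shows "\<exists>r\<in>carrier R. A = I +>\<^bsub>R\<^esub> r"
  using assms
  unfolding quotient_ring_module_simps FactRing_def A_RCOSETS_def' partial_object.simps by blast

lemma class_eq_iff:
  assumes "r \<in> carrier R" "t \<in> carrier R"
  shows "I +>\<^bsub>R\<^esub> r = I +>\<^bsub>R\<^esub> t \<longleftrightarrow> (\<exists>x\<in>carrier R. r = t \<oplus>\<^bsub>R\<^esub> a \<otimes>\<^bsub>R\<^esub> x)"
proof -
  have "I +>\<^bsub>R\<^esub> r = I +>\<^bsub>R\<^esub> t \<longleftrightarrow> r \<ominus>\<^bsub>R\<^esub> t \<in> I"
    by (rule M.R.quotient_eq_iff_same_a_r_cos[OF I.ideal_axioms assms, symmetric])
  also have "\<dots> \<longleftrightarrow> (\<exists>x\<in>carrier R. r \<ominus>\<^bsub>R\<^esub> t = a \<otimes>\<^bsub>R\<^esub> x)"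
    by (rule M.R.cgenideal_mem_iff[OF a])
  also have "\<dots> \<longleftrightarrow> (\<exists>x\<in>carrier R. r = t \<oplus>\<^bsub>R\<^esub> a \<otimes>\<^bsub>R\<^esub> x)"
    by (rule bex_cong[OF refl]) (rule M.R.minus_eq_iff[OF assms M.R.m_closed[OF a]])
  finally show ?thesis .
qed

text \<open>The action of \<open>R/(a)\<close> on \<open>M/aM\<close>, read as a pairing of \<open>M\<close> with \<open>R/(a)\<close>: a class \<open>A\<close> acts through
an arbitrary representative. It induces the inverse of \<open>M/aM \<rightarrow> M \<otimes> R/(a)\<close>.\<close>

definition reduction_pairing :: "'m \<Rightarrow> 'a set \<Rightarrow> 'm set"
  where "reduction_pairing m A =
    aM +>\<^bsub>M\<^esub> ((SOME r. r \<in> carrier R \<and> A = I +>\<^bsub>R\<^esub> r) \<odot>\<^bsub>M\<^esub> m)"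

lemma reduction_pairing_class:
  assumes m: "m \<in> carrier M" and r: "r \<in> carrier R"
  shows "reduction_pairing m (I +>\<^bsub>R\<^esub> r) = aM +>\<^bsub>M\<^esub> (r \<odot>\<^bsub>M\<^esub> m)"
proof -
  define t where "t = (SOME t. t \<in> carrier R \<and> I +>\<^bsub>R\<^esub> r = I +>\<^bsub>R\<^esub> t)"
  have "t \<in> carrier R \<and> I +>\<^bsub>R\<^esub> r = I +>\<^bsub>R\<^esub> t"
    unfolding t_def by (rule someI[of _ r]) (use r in blast)
  hence t: "t \<in> carrier R" "I +>\<^bsub>R\<^esub> t = I +>\<^bsub>R\<^esub> r" by (blast, rule conjunct2[THEN sym])
  obtain x where x: "x \<in> carrier R" "t = r \<oplus>\<^bsub>R\<^esub> a \<otimes>\<^bsub>R\<^esub> x"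
    using class_eq_iff[OF t(1) r] t(2) by blast
  have c: "r \<odot>\<^bsub>M\<^esub> m \<in> carrier M" "x \<odot>\<^bsub>M\<^esub> m \<in> carrier M" "a \<otimes>\<^bsub>R\<^esub> x \<in> carrier R"
    "t \<odot>\<^bsub>M\<^esub> m \<in> carrier M"
    using m r x(1) a t(1) by simp_all
  have "t \<odot>\<^bsub>M\<^esub> m = r \<odot>\<^bsub>M\<^esub> m \<oplus>\<^bsub>M\<^esub> a \<odot>\<^bsub>M\<^esub> (x \<odot>\<^bsub>M\<^esub> m)"
    unfolding x(2) M.smult_l_distr[OF r c(3) m] M.smult_assoc1[OF a x(1) m] by (rule refl)
  hence "t \<odot>\<^bsub>M\<^esub> m \<ominus>\<^bsub>M\<^esub> r \<odot>\<^bsub>M\<^esub> m = a \<odot>\<^bsub>M\<^esub> (x \<odot>\<^bsub>M\<^esub> m)"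
    using M.M.minus_eq_iff[OF c(4,1) M.smult_closed[OF a c(2)]] by blast
  hence "t \<odot>\<^bsub>M\<^esub> m \<ominus>\<^bsub>M\<^esub> r \<odot>\<^bsub>M\<^esub> m \<in> aM" by (rule image_eqI[OF _ c(2)])
  hence "aM +>\<^bsub>M\<^esub> (t \<odot>\<^bsub>M\<^esub> m) = aM +>\<^bsub>M\<^esub> (r \<odot>\<^bsub>M\<^esub> m)"
    using quotient_class_eq_iff[OF M multiples_submodule c(4,1)] by blast
  thus ?thesis unfolding reduction_pairing_def t_def .
qed

lemma reduction_pairing_bilinear:
  "reduction_pairing \<in> bilinear_map R M Q (quotient_module M aM)"
proof -
  note h = module_homD[OF quotient_class_hom[OF M multiples_submodule]]
  note hom = I.rcos_ring_hom
  note p = reduction_pairing_class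
  have "(\<lambda>m. reduction_pairing m A) \<in> module_hom R M (quotient_module M aM)" if A: "A \<in> carrier Q" for A
  proof -
    obtain r where r: "r \<in> carrier R" "A = I +>\<^bsub>R\<^esub> r" using quotient_ring_module_ex[OF A] by blast
    have "(\<lambda>m. reduction_pairing m A) \<in> module_hom R M (quotient_module M aM) \<longleftrightarrow>
        (\<lambda>m. aM +>\<^bsub>M\<^esub> (r \<odot>\<^bsub>M\<^esub> m)) \<in> module_hom R M (quotient_module M aM)"
      by (simp add: module_hom_def Pi_iff p r cong: ball_cong)
    thus ?thesis
      using module_hom_compose[OF smult_hom[OF r(1)] quotient_class_hom[OF M multiples_submodule]] by blast
  qed
  moreover have "reduction_pairing m \<in> module_hom R Q (quotient_module M aM)" if m: "m \<in> carrier M" for m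
  proof (rule module_homI)
    fix A assume "A \<in> carrier Q"
    then obtain r where r: "r \<in> carrier R" "A = I +>\<^bsub>R\<^esub> r" using quotient_ring_module_ex by blast
    show "reduction_pairing m A \<in> carrier (quotient_module M aM)"
      unfolding r(2) p[OF m r(1)] by (rule h(1)) (simp add: r m)
    show "reduction_pairing m (t \<odot>\<^bsub>Q\<^esub> A) = t \<odot>\<^bsub>quotient_module M aM\<^esub> reduction_pairing m A"
      if t: "t \<in> carrier R" for t
    proof -
      have "t \<odot>\<^bsub>Q\<^esub> A = I +>\<^bsub>R\<^esub> (t \<otimes>\<^bsub>R\<^esub> r)"
        unfolding r(2) ring_hom_mult[OF hom t r(1)] by (simp only: quotient_ring_module_simps)
      hence "reduction_pairing m (t \<odot>\<^bsub>Q\<^esub> A) = aM +>\<^bsub>M\<^esub> (t \<odot>\<^bsub>M\<^esub> (r \<odot>\<^bsub>M\<^esub> m))"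
        using p[OF m, of "t \<otimes>\<^bsub>R\<^esub> r"] r t m by (simp add: M.smult_assoc1)
      also have "\<dots> = t \<odot>\<^bsub>quotient_module M aM\<^esub> (aM +>\<^bsub>M\<^esub> (r \<odot>\<^bsub>M\<^esub> m))"
        by (rule h(3)) (simp_all add: r t m)
      finally show ?thesis unfolding r(2) p[OF m r(1)] .
    qed
    fix B assume "B \<in> carrier Q"
    then obtain t where t: "t \<in> carrier R" "B = I +>\<^bsub>R\<^esub> t" using quotient_ring_module_ex by blast
    have "A \<oplus>\<^bsub>Q\<^esub> B = I +>\<^bsub>R\<^esub> (r \<oplus>\<^bsub>R\<^esub> t)"
      unfolding r(2) t(2) ring_hom_add[OF hom r(1) t(1)] by (simp only: quotient_ring_module_simps)
    hence "reduction_pairing m (A \<oplus>\<^bsub>Q\<^esub> B) = aM +>\<^bsub>M\<^esub> (r \<odot>\<^bsub>M\<^esub> m \<oplus>\<^bsub>M\<^esub> t \<odot>\<^bsub>M\<^esub> m)"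
      using p[OF m, of "r \<oplus>\<^bsub>R\<^esub> t"] r t m by (simp add: M.smult_l_distr)
    also have "\<dots> = (aM +>\<^bsub>M\<^esub> (r \<odot>\<^bsub>M\<^esub> m)) \<oplus>\<^bsub>quotient_module M aM\<^esub> (aM +>\<^bsub>M\<^esub> (t \<odot>\<^bsub>M\<^esub> m))"
      by (rule h(2)) (simp_all add: r t m)
    finally show "reduction_pairing m (A \<oplus>\<^bsub>Q\<^esub> B) =
        reduction_pairing m A \<oplus>\<^bsub>quotient_module M aM\<^esub> reduction_pairing m B"
      unfolding r(2) t(2) p[OF m r(1)] p[OF m t(1)] .
  qed
  ultimately show ?thesis by (simp add: bilinear_map_def)
qed

lemma one_quotient_closed: "\<one>\<^bsub>Q\<^esub> \<in> carrier Q"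
  unfolding one_quotient_ring_module by (rule class_quotient_ring_module(1)[OF M.R.one_closed])

lemma tensor_one_hom: "(\<lambda>m. pure_tensor R M Q m \<one>\<^bsub>Q\<^esub>) \<in> module_hom R M T"
  by (rule bilinear_mapD(1)[OF pure_tensor_bilinear[OF M Q.module_axioms] one_quotient_closed])

text \<open>The \<open>R\<close>-module \<open>R/(a)\<close> is generated by its unit element, so \<open>m \<otimes> (r \<cdot> 1) = rm \<otimes> 1\<close>.\<close>

lemma tensor_one_surj: "(\<lambda>m. pure_tensor R M Q m \<one>\<^bsub>Q\<^esub>) ` carrier M = carrier T"
proof (rule tensor_product_generated[OF M Q.module_axioms])
  show "submodule ((\<lambda>m. pure_tensor R M Q m \<one>\<^bsub>Q\<^esub>) ` carrier M) R T"
    by (rule submodule_image[OF M T.module_axioms tensor_one_hom])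
  fix m A assume m: "m \<in> carrier M" and A: "A \<in> carrier Q"
  note bil = pure_tensor_bilinear[OF M Q.module_axioms]
  obtain r where r: "r \<in> carrier R" "A = I +>\<^bsub>R\<^esub> r" using quotient_ring_module_ex[OF A] by blast
  have "pure_tensor R M Q m A = r \<odot>\<^bsub>T\<^esub> pure_tensor R M Q m \<one>\<^bsub>Q\<^esub>"
    unfolding r(2) class_quotient_ring_module(2)[OF r(1)]
    by (rule module_homD(3)[OF bilinear_mapD(2)[OF bil m] r(1) one_quotient_closed])
  also have "\<dots> = pure_tensor R M Q (r \<odot>\<^bsub>M\<^esub> m) \<one>\<^bsub>Q\<^esub>"
    by (rule module_homD(3)[OF tensor_one_hom r(1) m, symmetric])
  finally show "pure_tensor R M Q m A \<in> (\<lambda>m. pure_tensor R M Q m \<one>\<^bsub>Q\<^esub>) ` carrier M"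
    by (rule image_eqI) (simp add: r m)
qed

text \<open>If \<open>m \<otimes> 1\<close> vanishes, then so does its image \<open>m + aM\<close> under the map induced by the pairing.
Conversely \<open>am' \<otimes> 1 = m' \<otimes> a\<close>, and \<open>a\<close> is zero in \<open>R/(a)\<close>.\<close>

lemma tensor_one_eq_zero_iff:
  assumes m: "m \<in> carrier M"
  shows "pure_tensor R M Q m \<one>\<^bsub>Q\<^esub> = \<zero>\<^bsub>T\<^esub> \<longleftrightarrow> m \<in> aM"
proof
  let ?L = "\<lambda>A. the_elem (free_lift R (quotient_module M aM) (\<lambda>q. reduction_pairing (fst q) (snd q)) ` A)"
  note qm = quotient_module_module[OF M multiples_submodule]
  note L = tensor_lift_hom[OF M Q.module_axioms qm reduction_pairing_bilinear]
    tensor_lift_pure[OF M Q.module_axioms qm reduction_pairing_bilinear m one_quotient_closed]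
  assume "pure_tensor R M Q m \<one>\<^bsub>Q\<^esub> = \<zero>\<^bsub>T\<^esub>"
  hence "reduction_pairing m \<one>\<^bsub>Q\<^esub> = ?L \<zero>\<^bsub>T\<^esub>" using L(2) by simp
  also have "\<dots> = \<zero>\<^bsub>quotient_module M aM\<^esub>" by (rule module_hom_zero[OF T.module_axioms qm L(1)])
  finally have "aM +>\<^bsub>M\<^esub> m = aM"
    using m by (simp add: one_quotient_ring_module reduction_pairing_class quotient_module_simps)
  thus "m \<in> aM" using quotient_class_eq_zero_iff[OF M multiples_submodule m] by simp
next
  assume "m \<in> aM"
  then obtain m' where m': "m' \<in> carrier M" "m = a \<odot>\<^bsub>M\<^esub> m'" by blast
  note bil = pure_tensor_bilinear[OF M Q.module_axioms]
  have "I +>\<^bsub>R\<^esub> a = I"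
    by (rule I.a_rcos_const[OF M.R.cgenideal_self[OF a]])
  hence "a \<odot>\<^bsub>Q\<^esub> \<one>\<^bsub>Q\<^esub> = \<zero>\<^bsub>Q\<^esub>"
    unfolding class_quotient_ring_module(2)[OF a, symmetric]
    by (simp only: quotient_ring_module_simps FactRing_def ring.simps)
  have "pure_tensor R M Q m \<one>\<^bsub>Q\<^esub> = a \<odot>\<^bsub>T\<^esub> pure_tensor R M Q m' \<one>\<^bsub>Q\<^esub>"
    unfolding m'(2) by (rule module_homD(3)[OF tensor_one_hom a m'(1)])
  also have "\<dots> = pure_tensor R M Q m' (a \<odot>\<^bsub>Q\<^esub> \<one>\<^bsub>Q\<^esub>)"
    by (rule module_homD(3)[OF bilinear_mapD(2)[OF bil m'(1)] a one_quotient_closed, symmetric])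
  also have "\<dots> = \<zero>\<^bsub>T\<^esub>"
    unfolding \<open>a \<odot>\<^bsub>Q\<^esub> \<one>\<^bsub>Q\<^esub> = \<zero>\<^bsub>Q\<^esub>\<close>
    by (rule module_hom_zero[OF Q.module_axioms T.module_axioms bilinear_mapD(2)[OF bil m'(1)]])
  finally show "pure_tensor R M Q m \<one>\<^bsub>Q\<^esub> = \<zero>\<^bsub>T\<^esub>" .
qed

end

section \<open>Cohomology of complexes reduced modulo an element\<close>

text \<open>The record of complexes carries no axioms; this predicate supplies them.\<close>

definition is_complex :: "[('a, 'x) ring_scheme, ('a, 'm, 'y) cochain_complex] \<Rightarrow> bool"
  where "is_complex R C \<longleftrightarrow>
    (\<forall>j. module R (cterm C j)) \<and>
    (\<forall>j. cdiff C j \<in> module_hom R (cterm C j) (cterm C (j + 1))) \<and>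
    (\<forall>j. \<forall>x\<in>carrier (cterm C j). cdiff C (j + 1) (cdiff C j x) = \<zero>\<^bsub>cterm C (j + 1 + 1)\<^esub>)"

lemma is_complexD:
  assumes "is_complex R C"
  shows "module R (cterm C j)"
    and "cdiff C j \<in> module_hom R (cterm C j) (cterm C (j + 1))"
    and "cdiff C (j - 1) \<in> module_hom R (cterm C (j - 1)) (cterm C j)"
    and "x \<in> carrier (cterm C j) \<Longrightarrow> cdiff C (j + 1) (cdiff C j x) = \<zero>\<^bsub>cterm C (j + 1 + 1)\<^esub>"
    and "x \<in> carrier (cterm C (j - 1)) \<Longrightarrow> cdiff C j (cdiff C (j - 1) x) = \<zero>\<^bsub>cterm C (j + 1)\<^esub>"
proof -
  have all: "\<And>j. module R (cterm C j)" "\<And>j. cdiff C j \<in> module_hom R (cterm C j) (cterm C (j + 1))"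
    "\<And>j x. x\<in>carrier (cterm C j) \<Longrightarrow> cdiff C (j + 1) (cdiff C j x) = \<zero>\<^bsub>cterm C (j + 1 + 1)\<^esub>"
    using assms by (simp_all add: is_complex_def)
  show "module R (cterm C j)" "cdiff C j \<in> module_hom R (cterm C j) (cterm C (j + 1))"
    "cdiff C (j - 1) \<in> module_hom R (cterm C (j - 1)) (cterm C j)"
    using all(1) all(2)[of j] all(2)[of "j - 1"] by simp_all
  show "x \<in> carrier (cterm C j) \<Longrightarrow> cdiff C (j + 1) (cdiff C j x) = \<zero>\<^bsub>cterm C (j + 1 + 1)\<^esub>"
    by (rule all(3))
  show "x \<in> carrier (cterm C (j - 1)) \<Longrightarrow> cdiff C j (cdiff C (j - 1) x) = \<zero>\<^bsub>cterm C (j + 1)\<^esub>"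
    using all(3)[of x "j - 1"] by simp
qed

context
  fixes R :: "('a, 'x) ring_scheme" and C :: "('a, 'm, 'y) cochain_complex" and i :: int
  assumes C: "is_complex R C"
begin

private abbreviation (input) Z where "Z \<equiv> (cterm C i)\<lparr>carrier := cocycles C i\<rparr>"

lemma cocycles_submodule: "submodule (cocycles C i) R (cterm C i)"
  unfolding cocycles_def by (rule submodule_kernel[OF is_complexD(1)[OF C] is_complexD(1)[OF C] is_complexD(2)[OF C]])

lemma cocycles_module: "module R Z"
  by (rule submodule.submodule_is_module[OF cocycles_submodule is_complexD(1)[OF C]])

lemma coboundaries_submodule: "submodule (coboundaries C i) R Z"
proof (rule module.module_incl_imp_submodule[OF cocycles_module])
  have B: "submodule (coboundaries C i) R (cterm C i)"
    unfolding coboundaries_def by (rule submodule_image[OF is_complexD(1)[OF C] is_complexD(1)[OF C] is_complexD(3)[OF C]])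
  show "coboundaries C i \<subseteq> carrier Z"
    using is_complexD(5)[OF C] module_homD(1)[OF is_complexD(3)[OF C]]
    by (auto simp: coboundaries_def cocycles_def)
  show "module R (Z\<lparr>carrier := coboundaries C i\<rparr>)"
    using submodule.submodule_is_module[OF B is_complexD(1)[OF C]] by simp
qed

text \<open>Cosets depend only on the addition, so they are the same whether they are formed in the full term
or in the module of cocycles. This makes the results on quotient modules applicable to cohomology.\<close>

lemma cohomology_class_eq: "cohomology_class C i = (\<lambda>x. coboundaries C i +>\<^bsub>Z\<^esub> x)"
  by (rule ext) (simp add: cohomology_class_def a_r_coset_def')

lemma cohomology_module: "module R (cohomology C i)"
  unfolding cohomology_def by (rule quotient_module_module[OF cocycles_module coboundaries_submodule])

lemma cohomology_class_hom: "cohomology_class C i \<in> module_hom R Z (cohomology C i)"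
  unfolding cohomology_def cohomology_class_eq
  by (rule quotient_class_hom[OF cocycles_module coboundaries_submodule])

lemma cohomology_class_surj: "cohomology_class C i ` cocycles C i = carrier (cohomology C i)"
  using quotient_class_surj[OF cocycles_module coboundaries_submodule]
  unfolding cohomology_def cohomology_class_eq by simp

lemma cohomology_class_zero_iff:
  assumes "x \<in> cocycles C i"
  shows "cohomology_class C i x = \<zero>\<^bsub>cohomology C i\<^esub> \<longleftrightarrow> x \<in> coboundaries C i"
  using quotient_class_eq_zero_iff[OF cocycles_module coboundaries_submodule, of x] assms
  unfolding cohomology_def cohomology_class_eq by (simp add: quotient_module_simps)

end

lemma tensor_complex_simps:
  "cterm (tensor_complex R C N) i = tensor_product R (cterm C i) N"
  "cdiff (tensor_complex R C N) i = tensor_map R (cterm C (i + 1)) N (cdiff C i) id"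
  by (simp_all add: tensor_complex_def)

lemma module_hom_id: "id \<in> module_hom R N N"
  by (simp add: module_hom_def)

lemma tensor_complex_diff_pure:
  assumes C: "is_complex R C" and N: "module R N"
    and m: "m \<in> carrier (cterm C j)" and n: "n \<in> carrier N"
  shows "cdiff (tensor_complex R C N) j (pure_tensor R (cterm C j) N m n) =
    pure_tensor R (cterm C (j + 1)) N (cdiff C j m) n"
  using tensor_map_pure[OF is_complexD(1)[OF C] N is_complexD(1)[OF C] N is_complexD(2)[OF C]
      module_hom_id m n]
  by (simp add: tensor_complex_simps)

text \<open>The composite of two differentials is linear, so it is enough that it vanishes on pure tensors.\<close>

lemma tensor_complex_is_complex:
  assumes C: "is_complex R C" and N: "module R N"
  shows "is_complex R (tensor_complex R C N)"
proof -
  let ?D = "tensor_complex R C N"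
  note M = is_complexD(1)[OF C]
  have mods: "module R (cterm ?D j)" for j
    unfolding tensor_complex_simps by (rule tensor_product_module[OF M N])
  have diff: "cdiff ?D j \<in> module_hom R (cterm ?D j) (cterm ?D (j + 1))" for j
    unfolding tensor_complex_simps
    by (rule tensor_map_hom[OF M N M N is_complexD(2)[OF C] module_hom_id])
  have "{t \<in> carrier (cterm ?D j). cdiff ?D (j + 1) (cdiff ?D j t) = \<zero>\<^bsub>cterm ?D (j + 1 + 1)\<^esub>} =
      carrier (tensor_product R (cterm C j) N)" (is "?H = _") for j
  proof (rule tensor_product_generated[OF M N])
    show "submodule ?H R (tensor_product R (cterm C j) N)"
      using submodule_kernel[OF mods mods module_hom_compose[OF diff diff], of j]
      by (simp only: tensor_complex_simps(1))
    fix m n assume mn: "m \<in> carrier (cterm C j)" "n \<in> carrier N"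
    have dm: "cdiff C j m \<in> carrier (cterm C (j + 1))"
      by (rule module_homD(1)[OF is_complexD(2)[OF C] mn(1)])
    have "cdiff ?D (j + 1) (cdiff ?D j (pure_tensor R (cterm C j) N m n)) =
        pure_tensor R (cterm C (j + 1 + 1)) N \<zero>\<^bsub>cterm C (j + 1 + 1)\<^esub> n"
      by (simp only: tensor_complex_diff_pure[OF C N mn] tensor_complex_diff_pure[OF C N dm mn(2)]
          is_complexD(4)[OF C mn(1)])
    also have "\<dots> = \<zero>\<^bsub>cterm ?D (j + 1 + 1)\<^esub>"
      unfolding tensor_complex_simps
      by (rule module_hom_zero[OF M tensor_product_module[OF M N]
            bilinear_mapD(1)[OF pure_tensor_bilinear[OF M N] mn(2)]])
    finally show "pure_tensor R (cterm C j) N m n \<in> ?H"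
      using pure_tensor_closed[OF M N mn] by (simp add: tensor_complex_simps(1))
  qed
  hence "cdiff ?D (j + 1) (cdiff ?D j t) = \<zero>\<^bsub>cterm ?D (j + 1 + 1)\<^esub>" if "t \<in> carrier (cterm ?D j)" for j t
    using that unfolding tensor_complex_simps(1) by blast
  thus ?thesis unfolding is_complex_def using mods diff by blast
qed

text \<open>The hypotheses \<open>cocycle\<close>, \<open>inj\<close> and \<open>surj\<close> involve only the original complex. Modulo \<open>a\<close> they
say that \<open>F\<close> takes values in cocycles, that only multiples of \<open>a\<close> are sent to coboundaries, and that
every cocycle is cohomologous to a value of \<open>F\<close>.\<close>

lemma reduction_cohomology_iso:
  fixes R :: "('a, 'x) ring_scheme" and C :: "('a, 'm, 'y) cochain_complex" and i :: int and a :: 'a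
  defines "Q \<equiv> quotient_ring_module R (PIdl\<^bsub>R\<^esub> a)"
  assumes C: "is_complex R C" and a: "a \<in> carrier R"
    and F: "F \<in> module_hom R (cterm C i) (cterm C i)"
    and cocycle: "\<And>f. f \<in> carrier (cterm C i) \<Longrightarrow>
      \<exists>k\<in>carrier (cterm C (i + 1)). cdiff C i (F f) = a \<odot>\<^bsub>cterm C (i + 1)\<^esub> k"
    and inj: "\<And>f h k. \<lbrakk>f \<in> carrier (cterm C i); h \<in> carrier (cterm C (i - 1)); k \<in> carrier (cterm C i);
      F f = cdiff C (i - 1) h \<oplus>\<^bsub>cterm C i\<^esub> a \<odot>\<^bsub>cterm C i\<^esub> k\<rbrakk> \<Longrightarrow>
      \<exists>k'\<in>carrier (cterm C i). f = a \<odot>\<^bsub>cterm C i\<^esub> k'"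
    and surj: "\<And>g k. \<lbrakk>g \<in> carrier (cterm C i); k \<in> carrier (cterm C (i + 1));
      cdiff C i g = a \<odot>\<^bsub>cterm C (i + 1)\<^esub> k\<rbrakk> \<Longrightarrow>
      \<exists>f\<in>carrier (cterm C i). \<exists>h\<in>carrier (cterm C (i - 1)). \<exists>k\<in>carrier (cterm C i).
        g = F f \<oplus>\<^bsub>cterm C i\<^esub> (cdiff C (i - 1) h \<oplus>\<^bsub>cterm C i\<^esub> a \<odot>\<^bsub>cterm C i\<^esub> k)"
  shows "\<exists>\<phi>\<in>module_iso R (tensor_product R (cterm C i) Q) (cohomology (tensor_complex R C Q) i).
    \<forall>f\<in>carrier (cterm C i). \<phi> (pure_tensor R (cterm C i) Q f \<one>\<^bsub>Q\<^esub>) =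
      cohomology_class (tensor_complex R C Q) i (pure_tensor R (cterm C i) Q (F f) \<one>\<^bsub>Q\<^esub>)"
proof -
  define D where "D = tensor_complex R C Q"
  define \<pi> where "\<pi> j f = pure_tensor R (cterm C j) Q f \<one>\<^bsub>Q\<^esub>" for j f
  note M = is_complexD(1)[OF C]
  interpret M0: module R "cterm C (i - 1)" by (rule M)
  interpret M1: module R "cterm C i" by (rule M)
  interpret M2: module R "cterm C (i + 1)" by (rule M)
  have Q: "module R Q" unfolding Q_def
    by (rule quotient_ring_module_module[OF M0.R.cring_axioms M0.R.cgenideal_ideal[OF a]])
  have D: "is_complex R D" unfolding D_def by (rule tensor_complex_is_complex[OF C Q])
  have Dt: "cterm D j = tensor_product R (cterm C j) Q" for j
    by (simp add: D_def tensor_complex_simps)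
  note T = is_complexD(1)[OF D]
  interpret T1: module R "cterm D i" by (rule T)
  note one = one_quotient_closed[OF M1.module_axioms a, folded Q_def]
  have \<pi>hom: "\<pi> j \<in> module_hom R (cterm C j) (cterm D j)" for j
    unfolding \<pi>_def[abs_def] Dt Q_def by (rule tensor_one_hom[OF M a])
  have \<pi>surj: "\<pi> j ` carrier (cterm C j) = carrier (cterm D j)" for j
    unfolding \<pi>_def[abs_def] Dt Q_def by (rule tensor_one_surj[OF M a])
  have \<pi>zero: "\<pi> j f = \<zero>\<^bsub>cterm D j\<^esub> \<longleftrightarrow> (\<exists>k\<in>carrier (cterm C j). f = a \<odot>\<^bsub>cterm C j\<^esub> k)"
    if "f \<in> carrier (cterm C j)" for j f
    unfolding \<pi>_def Dt Q_def using tensor_one_eq_zero_iff[OF M a that] by blast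
  have \<pi>d: "cdiff D j (\<pi> j f) = \<pi> (j + 1) (cdiff C j f)" if "f \<in> carrier (cterm C j)" for j f
    unfolding \<pi>_def D_def by (rule tensor_complex_diff_pure[OF C Q that one])
  have \<pi>d': "cdiff D (i - 1) (\<pi> (i - 1) f) = \<pi> i (cdiff C (i - 1) f)"
    if "f \<in> carrier (cterm C (i - 1))" for f
    using \<pi>d[OF that] by simp
  note d = module_homD(1)[OF is_complexD(2)[OF C]]
  note d' = module_homD(1)[OF is_complexD(3)[OF C]]
  have \<pi>cocycle: "\<pi> i f \<in> cocycles D i \<longleftrightarrow>
      (\<exists>k\<in>carrier (cterm C (i + 1)). cdiff C i f = a \<odot>\<^bsub>cterm C (i + 1)\<^esub> k)"
    if f: "f \<in> carrier (cterm C i)" for f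
    using module_homD(1)[OF \<pi>hom f] \<pi>zero[OF d[OF f]]
    by (simp add: cocycles_def \<pi>d[OF f])
  have \<pi>eq: "\<pi> i f = \<pi> i g \<longleftrightarrow> (\<exists>k\<in>carrier (cterm C i). f = g \<oplus>\<^bsub>cterm C i\<^esub> a \<odot>\<^bsub>cterm C i\<^esub> k)"
    if fg: "f \<in> carrier (cterm C i)" "g \<in> carrier (cterm C i)" for f g
  proof -
    have "\<pi> i f = \<pi> i g \<longleftrightarrow> \<pi> i (f \<ominus>\<^bsub>cterm C i\<^esub> g) = \<zero>\<^bsub>cterm D i\<^esub>"
      unfolding module_hom_minus[OF M T \<pi>hom fg]
      by (rule module_minus_zero_iff[OF T, symmetric]) (rule module_homD(1)[OF \<pi>hom], rule fg)+
    also have "\<dots> \<longleftrightarrow> (\<exists>k\<in>carrier (cterm C i). f \<ominus>\<^bsub>cterm C i\<^esub> g = a \<odot>\<^bsub>cterm C i\<^esub> k)"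
      by (rule \<pi>zero) (rule M1.M.minus_closed[OF fg])
    also have "\<dots> \<longleftrightarrow> (\<exists>k\<in>carrier (cterm C i). f = g \<oplus>\<^bsub>cterm C i\<^esub> a \<odot>\<^bsub>cterm C i\<^esub> k)"
      by (rule bex_cong[OF refl]) (rule M1.M.minus_eq_iff[OF fg M1.smult_closed[OF a]])
    finally show ?thesis .
  qed
  have \<pi>coboundary: "\<pi> i f \<in> coboundaries D i \<longleftrightarrow>
      (\<exists>h\<in>carrier (cterm C (i - 1)). \<exists>k\<in>carrier (cterm C i).
        f = cdiff C (i - 1) h \<oplus>\<^bsub>cterm C i\<^esub> a \<odot>\<^bsub>cterm C i\<^esub> k)"
    if f: "f \<in> carrier (cterm C i)" for f
  proof -
    have "coboundaries D i = (\<lambda>h. \<pi> i (cdiff C (i - 1) h)) ` carrier (cterm C (i - 1))"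
      unfolding coboundaries_def \<pi>surj[symmetric] image_image
      by (rule image_cong[OF refl]) (rule \<pi>d')
    hence "\<pi> i f \<in> coboundaries D i \<longleftrightarrow>
        (\<exists>h\<in>carrier (cterm C (i - 1)). \<pi> i f = \<pi> i (cdiff C (i - 1) h))" by blast
    also have "\<dots> \<longleftrightarrow> (\<exists>h\<in>carrier (cterm C (i - 1)). \<exists>k\<in>carrier (cterm C i).
        f = cdiff C (i - 1) h \<oplus>\<^bsub>cterm C i\<^esub> a \<odot>\<^bsub>cterm C i\<^esub> k)"
      by (rule bex_cong[OF refl]) (rule \<pi>eq[OF f d'])
    finally show ?thesis .
  qed
  note Fc = module_homD(1)[OF F]
  let ?\<beta> = "\<lambda>f. cohomology_class D i (\<pi> i (F f))"
  have coc: "\<pi> i (F f) \<in> cocycles D i" if "f \<in> carrier (cterm C i)" for f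
    unfolding \<pi>cocycle[OF Fc[OF that]] by (rule cocycle[OF that])
  let ?Z = "(cterm D i)\<lparr>carrier := cocycles D i\<rparr>"
  have "(\<lambda>f. \<pi> i (F f)) \<in> module_hom R (cterm C i) ?Z"
    using module_homD[OF module_hom_compose[OF F \<pi>hom]] coc
    by (intro module_homI) simp_all
  hence \<beta>hom: "?\<beta> \<in> module_hom R (cterm C i) (cohomology D i)"
    by (rule module_hom_compose[OF _ cohomology_class_hom[OF D]])
  have \<beta>zero: "\<pi> i f = \<zero>\<^bsub>cterm D i\<^esub> \<longleftrightarrow> ?\<beta> f = \<zero>\<^bsub>cohomology D i\<^esub>" if f: "f \<in> carrier (cterm C i)" for f
  proof -
    have "?\<beta> f = \<zero>\<^bsub>cohomology D i\<^esub> \<longleftrightarrow> (\<exists>h\<in>carrier (cterm C (i - 1)). \<exists>k\<in>carrier (cterm C i).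
        F f = cdiff C (i - 1) h \<oplus>\<^bsub>cterm C i\<^esub> a \<odot>\<^bsub>cterm C i\<^esub> k)"
      unfolding cohomology_class_zero_iff[OF D coc[OF f]] by (rule \<pi>coboundary[OF Fc[OF f]])
    also have "\<dots> \<longleftrightarrow> (\<exists>k\<in>carrier (cterm C i). f = a \<odot>\<^bsub>cterm C i\<^esub> k)"
    proof
      assume "\<exists>k\<in>carrier (cterm C i). f = a \<odot>\<^bsub>cterm C i\<^esub> k"
      then obtain k where k: "k \<in> carrier (cterm C i)" "f = a \<odot>\<^bsub>cterm C i\<^esub> k" by blast
      have "cdiff C (i - 1) \<zero>\<^bsub>cterm C (i - 1)\<^esub> = \<zero>\<^bsub>cterm C i\<^esub>"
        by (rule module_hom_zero[OF M M is_complexD(3)[OF C]])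
      hence "F f = cdiff C (i - 1) \<zero>\<^bsub>cterm C (i - 1)\<^esub> \<oplus>\<^bsub>cterm C i\<^esub> a \<odot>\<^bsub>cterm C i\<^esub> F k"
        using Fc[OF k(1)] a by (simp add: k(2) module_homD(3)[OF F a k(1)])
      thus "\<exists>h\<in>carrier (cterm C (i - 1)). \<exists>k\<in>carrier (cterm C i).
          F f = cdiff C (i - 1) h \<oplus>\<^bsub>cterm C i\<^esub> a \<odot>\<^bsub>cterm C i\<^esub> k"
        using M0.M.zero_closed Fc[OF k(1)] by blast
    qed (use inj[OF f] in blast)
    also have "\<dots> \<longleftrightarrow> \<pi> i f = \<zero>\<^bsub>cterm D i\<^esub>" by (rule \<pi>zero[OF f, symmetric])
    finally show ?thesis by blast
  qed
  have \<beta>surj: "?\<beta> ` carrier (cterm C i) = carrier (cohomology D i)"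
  proof
    show "?\<beta> ` carrier (cterm C i) \<subseteq> carrier (cohomology D i)"
      using module_homD(1)[OF \<beta>hom] by blast
    show "carrier (cohomology D i) \<subseteq> ?\<beta> ` carrier (cterm C i)"
    proof
      fix c assume "c \<in> carrier (cohomology D i)"
      then obtain z where z: "z \<in> cocycles D i" "c = cohomology_class D i z"
        using cohomology_class_surj[OF D] by blast
      hence "z \<in> \<pi> i ` carrier (cterm C i)" unfolding \<pi>surj by (simp add: cocycles_def)
      then obtain g where g: "g \<in> carrier (cterm C i)" "z = \<pi> i g" by blast
      obtain k where "k \<in> carrier (cterm C (i + 1))" "cdiff C i g = a \<odot>\<^bsub>cterm C (i + 1)\<^esub> k"
        using z(1) \<pi>cocycle[OF g(1)] unfolding g(2) by blast
      then obtain f h k' where f: "f \<in> carrier (cterm C i)" and h: "h \<in> carrier (cterm C (i - 1))"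
        and k': "k' \<in> carrier (cterm C i)"
        and e: "g = F f \<oplus>\<^bsub>cterm C i\<^esub> (cdiff C (i - 1) h \<oplus>\<^bsub>cterm C i\<^esub> a \<odot>\<^bsub>cterm C i\<^esub> k')"
        using surj[OF g(1)] by blast
      let ?b = "cdiff C (i - 1) h \<oplus>\<^bsub>cterm C i\<^esub> a \<odot>\<^bsub>cterm C i\<^esub> k'"
      have bc: "?b \<in> carrier (cterm C i)" using d'[OF h] k' a by simp
      have b: "\<pi> i ?b \<in> coboundaries D i" unfolding \<pi>coboundary[OF bc] using h k' by blast
      have bz: "\<pi> i ?b \<in> cocycles D i"
        using submodule.axioms(1)[OF coboundaries_submodule[OF D, of i]] b subgroup.subset by fastforce
      have "cohomology_class D i (\<pi> i g) = cohomology_class D i (\<pi> i (F f) \<oplus>\<^bsub>?Z\<^esub> \<pi> i ?b)"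
        unfolding e module_homD(2)[OF \<pi>hom Fc[OF f] bc] by simp
      also have "\<dots> = ?\<beta> f \<oplus>\<^bsub>cohomology D i\<^esub> cohomology_class D i (\<pi> i ?b)"
        using coc[OF f] bz by (intro module_homD(2)[OF cohomology_class_hom[OF D]]) simp_all
      also have "\<dots> = ?\<beta> f \<oplus>\<^bsub>cohomology D i\<^esub> \<zero>\<^bsub>cohomology D i\<^esub>"
        using b cohomology_class_zero_iff[OF D bz] by simp
      also have "\<dots> = ?\<beta> f"
        by (rule abelian_monoid.r_zero[OF abelian_group.axioms(1)[OF module.axioms(2)[OF cohomology_module[OF D]]]
              module_homD(1)[OF \<beta>hom f]])
      finally show "c \<in> ?\<beta> ` carrier (cterm C i)" unfolding z(2) g(2) using f by blast
    qed
  qed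
  have "\<exists>\<phi>\<in>module_iso R (cterm D i) (cohomology D i). \<forall>f\<in>carrier (cterm C i). \<phi> (\<pi> i f) = ?\<beta> f"
    by (rule module_iso_if_equal_kernels[OF M T cohomology_module[OF D] \<pi>hom \<beta>hom \<pi>surj \<beta>surj \<beta>zero])
  thus ?thesis unfolding \<pi>_def D_def tensor_complex_simps(1) .
qed

section \<open>Generalized n-series modulo a prime index\<close>

context
  fixes R :: "('a, 'x) ring_scheme" and s :: "nat \<Rightarrow> 'a"
  assumes R: "cring R" and s: "generalized_n_series R s"
begin

interpretation R: cring R by (rule R)

lemma n_series_closed: "s n \<in> carrier R"
  using s by (auto simp: generalized_n_series_def)

lemma n_series_zero: "s 0 = \<zero>\<^bsub>R\<^esub>"
  using s by (simp add: generalized_n_series_def)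

lemma n_series_diff_mem:
  assumes "k > 0"
  shows "s (q + k) \<ominus>\<^bsub>R\<^esub> s k \<in> PIdl\<^bsub>R\<^esub> (s q)"
proof (cases "q = 0")
  case True
  interpret I: ideal "PIdl\<^bsub>R\<^esub> (s q)" R by (rule R.cgenideal_ideal[OF n_series_closed])
  have "s (q + k) \<ominus>\<^bsub>R\<^esub> s k = \<zero>\<^bsub>R\<^esub>"
    using True n_series_closed[of k] by (simp add: a_minus_def R.r_neg)
  thus ?thesis by simp
next
  case False
  have "\<forall>n k. n > k \<and> k > 0 \<longrightarrow> s (n - k) divides\<^bsub>R\<^esub> (s n \<ominus>\<^bsub>R\<^esub> s k)"
    using s by (simp add: generalized_n_series_def)
  hence "s (q + k - k) divides\<^bsub>R\<^esub> (s (q + k) \<ominus>\<^bsub>R\<^esub> s k)"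
    using assms False by (metis add_gr_0 less_add_same_cancel2 neq0_conv)
  thus ?thesis
    unfolding R.cgenideal_mem_iff[OF n_series_closed] factor_def by simp
qed

text \<open>Telescoping the divisibility \<open>s q \<bar> s (q + k) - s k\<close>. The restriction to positive \<open>k\<close> is inherited from
the axiom; the case \<open>k = 0\<close> is the next lemma.\<close>

lemma n_series_periodic:
  assumes "k > 0"
  shows "s (q * j + k) \<ominus>\<^bsub>R\<^esub> s k \<in> PIdl\<^bsub>R\<^esub> (s q)"
proof -
  interpret I: ideal "PIdl\<^bsub>R\<^esub> (s q)" R by (rule R.cgenideal_ideal[OF n_series_closed])
  show ?thesis
  proof (induction j)
    case 0
    have "s (q * 0 + k) \<ominus>\<^bsub>R\<^esub> s k = \<zero>\<^bsub>R\<^esub>"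
      using n_series_closed[of k] by (simp add: a_minus_def R.r_neg)
    thus ?case using I.zero_closed by (simp only:)
  next
    case (Suc j)
    let ?x = "s (q + (q * j + k))" and ?y = "s (q * j + k)" and ?z = "s k"
    have "(?x \<ominus>\<^bsub>R\<^esub> ?y) \<oplus>\<^bsub>R\<^esub> (?y \<ominus>\<^bsub>R\<^esub> ?z) \<in> PIdl\<^bsub>R\<^esub> (s q)"
      using n_series_diff_mem[of "q * j + k" q] assms Suc by (intro I.a_closed) simp_all
    moreover have "(?x \<ominus>\<^bsub>R\<^esub> ?y) \<oplus>\<^bsub>R\<^esub> (?y \<ominus>\<^bsub>R\<^esub> ?z) = ?x \<ominus>\<^bsub>R\<^esub> ?z"
      using n_series_closed[of "q + (q * j + k)"] n_series_closed[of "q * j + k"] n_series_closed[of k]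
      by algebra
    ultimately show ?case by (simp only: mult_Suc_right add.assoc)
  qed
qed

text \<open>Periodicity started at \<open>k = q\<close>: every positive multiple of \<open>q\<close> has the same value as \<open>q\<close> modulo \<open>s q\<close>,
namely zero.\<close>

lemma n_series_multiple_mem: "s (q * m) \<in> PIdl\<^bsub>R\<^esub> (s q)"
proof -
  interpret I: ideal "PIdl\<^bsub>R\<^esub> (s q)" R by (rule R.cgenideal_ideal[OF n_series_closed])
  show ?thesis
  proof (cases "q * m = 0")
    case True
    thus ?thesis using I.zero_closed by (simp only: n_series_zero)
  next
    case False
    then obtain j where "m = Suc j" by (cases m) auto
    hence m: "q * m = q * j + q" by simp
    have q: "s q \<in> PIdl\<^bsub>R\<^esub> (s q)" by (rule R.cgenideal_self[OF n_series_closed])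
    have "(s (q * j + q) \<ominus>\<^bsub>R\<^esub> s q) \<oplus>\<^bsub>R\<^esub> s q \<in> PIdl\<^bsub>R\<^esub> (s q)"
      using False by (intro I.a_closed n_series_periodic q) simp
    moreover have "(s (q * j + q) \<ominus>\<^bsub>R\<^esub> s q) \<oplus>\<^bsub>R\<^esub> s q = s (q * j + q)"
      using n_series_closed[of "q * j + q"] n_series_closed[of q] by algebra
    ultimately show ?thesis by (simp only: m)
  qed
qed

text \<open>With \<open>n x = 1 + p y\<close>, the value \<open>s n\<close> divides \<open>s (n x)\<close>, and the latter is congruent to the unit \<open>s 1\<close>
modulo \<open>s p\<close>. A divisor of a unit is a unit.\<close>

lemma n_series_invertible_mod:
  assumes p: "Factorial_Ring.prime p" and n: "\<not> p dvd n"
    and unit: "(PIdl\<^bsub>R\<^esub> (s p) +>\<^bsub>R\<^esub> s 1) \<in> Units (R Quot (PIdl\<^bsub>R\<^esub> (s p)))"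
  shows "\<exists>t\<in>carrier R. s n \<otimes>\<^bsub>R\<^esub> t \<ominus>\<^bsub>R\<^esub> \<one>\<^bsub>R\<^esub> \<in> PIdl\<^bsub>R\<^esub> (s p)"
proof -
  let ?I = "PIdl\<^bsub>R\<^esub> (s p)"
  interpret I: ideal ?I R by (rule R.cgenideal_ideal[OF n_series_closed])
  obtain B where B: "B \<in> carrier (R Quot ?I)"
    "(?I +>\<^bsub>R\<^esub> s 1) \<otimes>\<^bsub>R Quot ?I\<^esub> B = \<one>\<^bsub>R Quot ?I\<^esub>"
    using unit unfolding Units_def by blast
  obtain u where u: "u \<in> carrier R" "B = ?I +>\<^bsub>R\<^esub> u"
    using B(1) unfolding FactRing_def A_RCOSETS_def' partial_object.simps by blast
  have "?I +>\<^bsub>R\<^esub> (s 1 \<otimes>\<^bsub>R\<^esub> u) = ?I +>\<^bsub>R\<^esub> \<one>\<^bsub>R\<^esub>"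
    using B(2) unfolding u(2) ring_hom_mult[OF I.rcos_ring_hom n_series_closed u(1)]
      ring_hom_one[OF I.rcos_ring_hom] .
  hence s1: "s 1 \<otimes>\<^bsub>R\<^esub> u \<ominus>\<^bsub>R\<^esub> \<one>\<^bsub>R\<^esub> \<in> ?I"
    using R.quotient_eq_iff_same_a_r_cos[OF I.ideal_axioms R.m_closed[OF n_series_closed u(1)] R.one_closed]
    by blast
  obtain x y where xy: "n * x = Suc (p * y)" using bezout_prime[OF p n] by blast
  obtain c where c: "c \<in> carrier R" "s (n * x) = s n \<otimes>\<^bsub>R\<^esub> c"
    using n_series_multiple_mem[of n x] unfolding R.cgenideal_mem_iff[OF n_series_closed] by blast
  have nx: "s n \<otimes>\<^bsub>R\<^esub> c \<ominus>\<^bsub>R\<^esub> s 1 \<in> ?I"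
    using n_series_periodic[of 1 p y] by (simp only: flip: c(2)) (simp add: xy)
  \<comment> \<open>\<open>c\<close> is the cofactor of \<open>s n\<close> in \<open>s (n x)\<close> and \<open>u\<close> an inverse of \<open>s 1\<close>, so \<open>c u\<close> inverts \<open>s n\<close>.\<close>
  have "(s n \<otimes>\<^bsub>R\<^esub> c \<ominus>\<^bsub>R\<^esub> s 1) \<otimes>\<^bsub>R\<^esub> u \<oplus>\<^bsub>R\<^esub> (s 1 \<otimes>\<^bsub>R\<^esub> u \<ominus>\<^bsub>R\<^esub> \<one>\<^bsub>R\<^esub>) \<in> ?I"
    by (rule I.a_closed[OF I.I_r_closed[OF nx u(1)] s1])
  also have "(s n \<otimes>\<^bsub>R\<^esub> c \<ominus>\<^bsub>R\<^esub> s 1) \<otimes>\<^bsub>R\<^esub> u \<oplus>\<^bsub>R\<^esub> (s 1 \<otimes>\<^bsub>R\<^esub> u \<ominus>\<^bsub>R\<^esub> \<one>\<^bsub>R\<^esub>) =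
      s n \<otimes>\<^bsub>R\<^esub> (c \<otimes>\<^bsub>R\<^esub> u) \<ominus>\<^bsub>R\<^esub> \<one>\<^bsub>R\<^esub>"
    using n_series_closed[of n] n_series_closed[of 1] u(1) c(1) by algebra
  finally show ?thesis using R.m_closed[OF c(1) u(1)] by blast
qed

end

section \<open>Polynomials by their coefficients\<close>

context
  fixes R :: "('a, 'x) ring_scheme"
  assumes R: "cring R"
begin

interpretation R: cring R by (rule R)
interpretation UP_cring R "UP R" by unfold_locales

lemma UP_carrier: "carrier (UP R) = up R"
  by (simp add: UP_def)

text \<open>A polynomial is its coefficient function, so all module operations are pointwise. The equations
below allow coefficientwise arguments without the projection \<open>coeff\<close>.\<close>

lemma UP_eval:
  "f \<in> up R \<Longrightarrow> coeff (UP R) f = f"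
  "\<lbrakk>f \<in> up R; g \<in> up R\<rbrakk> \<Longrightarrow> f \<oplus>\<^bsub>UP R\<^esub> g = (\<lambda>n. f n \<oplus>\<^bsub>R\<^esub> g n)"
  "\<lbrakk>r \<in> carrier R; f \<in> up R\<rbrakk> \<Longrightarrow> r \<odot>\<^bsub>UP R\<^esub> f = (\<lambda>n. r \<otimes>\<^bsub>R\<^esub> f n)"
  "\<zero>\<^bsub>UP R\<^esub> = (\<lambda>n. \<zero>\<^bsub>R\<^esub>)"
  "r \<in> carrier R \<Longrightarrow> monom (UP R) r k = (\<lambda>n. if n = k then r else \<zero>\<^bsub>R\<^esub>)"
  by (simp_all add: UP_def fun_eq_iff)

lemma UP_module: "module R (UP R)"
  by (rule algebra.module[OF UP_algebra])

lemma upI: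
  assumes "\<And>n. f n \<in> carrier R" "\<And>n. n > N \<Longrightarrow> f n = \<zero>\<^bsub>R\<^esub>"
  shows "f \<in> up R"
  using assms by (intro mem_upI) auto

lemma upE:
  assumes "f \<in> up R"
  obtains N where "\<And>n. n > N \<Longrightarrow> f n = \<zero>\<^bsub>R\<^esub>"
  using assms by (auto simp: up_def bound_def)

text \<open>The quotients by \<open>a\<close> of the coefficients can be chosen independently of each other. They are set to zero beyond the degree of \<open>f\<close>, because \<open>a\<close> may be a
zero-divisor and the choice need not vanish there.\<close>

lemma UP_multiple_iff:
  assumes a: "a \<in> carrier R" and f: "f \<in> up R"
  shows "(\<exists>k\<in>up R. f = a \<odot>\<^bsub>UP R\<^esub> k) \<longleftrightarrow> (\<forall>n. f n \<in> PIdl\<^bsub>R\<^esub> a)"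
proof
  assume "\<exists>k\<in>up R. f = a \<odot>\<^bsub>UP R\<^esub> k"
  then obtain k where k: "k \<in> up R" "f = (\<lambda>n. a \<otimes>\<^bsub>R\<^esub> k n)" using UP_eval(3)[OF a] by auto
  thus "\<forall>n. f n \<in> PIdl\<^bsub>R\<^esub> a"
    using R.cgenideal_mem_iff[OF a] mem_upD[OF k(1)] by blast
next
  assume "\<forall>n. f n \<in> PIdl\<^bsub>R\<^esub> a"
  hence "\<forall>n. \<exists>y. y \<in> carrier R \<and> f n = a \<otimes>\<^bsub>R\<^esub> y" using R.cgenideal_mem_iff[OF a] by blast
  then obtain y where y: "\<And>n. y n \<in> carrier R" "\<And>n. f n = a \<otimes>\<^bsub>R\<^esub> y n" by metis
  obtain N where N: "\<And>n. n > N \<Longrightarrow> f n = \<zero>\<^bsub>R\<^esub>" by (rule upE[OF f]) blast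
  define k where "k n = (if n > N then \<zero>\<^bsub>R\<^esub> else y n)" for n
  have k: "k \<in> up R" by (rule upI[of _ N]) (simp_all add: k_def y)
  have "f = a \<odot>\<^bsub>UP R\<^esub> k"
    unfolding UP_eval(3)[OF a k] using N y a by (auto simp: k_def fun_eq_iff)
  thus "\<exists>k\<in>up R. f = a \<odot>\<^bsub>UP R\<^esub> k" using k by blast
qed

text \<open>The coefficient at \<open>m\<close> is taken from position \<open>e m\<close> for \<open>m\<close> in \<open>D\<close>, and is zero elsewhere. For a
bijection \<open>e\<close> from \<open>D\<close> to the natural numbers this is the substitution \<open>x^(e m) \<mapsto> x^m\<close>.\<close>

definition up_reindex :: "nat set \<Rightarrow> (nat \<Rightarrow> nat) \<Rightarrow> (nat \<Rightarrow> 'a) \<Rightarrow> nat \<Rightarrow> 'a"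
  where "up_reindex D e f = (\<lambda>m. if m \<in> D then f (e m) else \<zero>\<^bsub>R\<^esub>)"

text \<open>The monotone bound \<open>b\<close> guarantees that the support stays finite: a nonzero coefficient at \<open>m\<close> comes
from a position at most a degree bound \<open>N\<close>, so \<open>m\<close> is at most \<open>b N\<close>.\<close>

lemma up_reindex_closed:
  assumes e: "\<And>m. m \<in> D \<Longrightarrow> m \<le> b (e m)" and b: "mono (b :: nat \<Rightarrow> nat)" and f: "f \<in> up R"
  shows "up_reindex D e f \<in> up R"
proof -
  obtain N where N: "\<And>n. n > N \<Longrightarrow> f n = \<zero>\<^bsub>R\<^esub>" by (rule upE[OF f]) blast
  show ?thesis
  proof (rule upI[of _ "b N"])
    show "up_reindex D e f m \<in> carrier R" for m using mem_upD[OF f] by (simp add: up_reindex_def)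
    fix m assume m: "m > b N"
    have "e m > N" if "m \<in> D"
    proof (rule ccontr)
      assume "\<not> e m > N"
      hence "b (e m) \<le> b N" using b by (simp add: monoD)
      thus False using e[OF that] m by simp
    qed
    thus "up_reindex D e f m = \<zero>\<^bsub>R\<^esub>" using N by (simp add: up_reindex_def)
  qed
qed

lemma up_reindex_hom:
  assumes e: "\<And>m. m \<in> D \<Longrightarrow> m \<le> b (e m)" and b: "mono (b :: nat \<Rightarrow> nat)"
  shows "up_reindex D e \<in> module_hom R (UP R) (UP R)"
proof (rule module_homI; unfold UP_carrier)
  note closed = up_reindex_closed[OF e b]
  fix f assume f: "f \<in> up R"
  show "up_reindex D e f \<in> up R" by (rule closed[OF _ f])
  show "up_reindex D e (r \<odot>\<^bsub>UP R\<^esub> f) = r \<odot>\<^bsub>UP R\<^esub> up_reindex D e f" if "r \<in> carrier R" for r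
    using that f closed[OF _ f] by (simp add: UP_eval) (simp add: up_reindex_def fun_eq_iff)
  fix g assume g: "g \<in> up R"
  show "up_reindex D e (f \<oplus>\<^bsub>UP R\<^esub> g) = up_reindex D e f \<oplus>\<^bsub>UP R\<^esub> up_reindex D e g"
    using f g closed[OF _ f] closed[OF _ g] by (simp add: UP_eval) (simp add: up_reindex_def fun_eq_iff)
qed

text \<open>The exponents \<open>0\<close> and \<open>1\<close> both contribute to the constant coefficient, because \<open>0 - 1 = 0\<close> for natural
numbers, but the contribution of the former is killed by \<open>s 0\<close>.\<close>

lemma sdR_nabla_eval:
  assumes s: "\<And>n. s n \<in> carrier R" and s0: "s 0 = \<zero>\<^bsub>R\<^esub>" and f: "f \<in> up R"
  shows "sdR_nabla R s f = (\<lambda>k. f (Suc k) \<otimes>\<^bsub>R\<^esub> s (Suc k))"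
proof
  fix k
  note [simp] = s mem_upD[OF f] UP_eval(1)[OF f]
  have mon: "(\<lambda>n. monom (UP R) (f n \<otimes>\<^bsub>R\<^esub> s n) (n - 1)) \<in> {..deg R f} \<rightarrow> carrier (UP R)"
    by (intro funcsetI monom_closed) simp
  have c: "sdR_nabla R s f \<in> up R"
    unfolding sdR_nabla_def UP_eval(1)[OF f] UP_carrier[symmetric] by (rule P.finsum_closed[OF mon])
  have "sdR_nabla R s f k = coeff (UP R) (sdR_nabla R s f) k" by (simp only: UP_eval(1)[OF c])
  also have "\<dots> = (\<Oplus>\<^bsub>R\<^esub>n\<in>{..deg R f}. coeff (UP R) (monom (UP R) (f n \<otimes>\<^bsub>R\<^esub> s n) (n - 1)) k)"
    unfolding sdR_nabla_def UP_eval(1)[OF f] by (rule coeff_finsum[OF finite_atMost mon])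
  also have "\<dots> = (\<Oplus>\<^bsub>R\<^esub>n\<in>{..deg R f}. if Suc k = n then f n \<otimes>\<^bsub>R\<^esub> s n else \<zero>\<^bsub>R\<^esub>)"
  proof (rule R.finsum_cong')
    fix n assume "n \<in> {..deg R f}"
    show "coeff (UP R) (monom (UP R) (f n \<otimes>\<^bsub>R\<^esub> s n) (n - 1)) k =
        (if Suc k = n then f n \<otimes>\<^bsub>R\<^esub> s n else \<zero>\<^bsub>R\<^esub>)"
      by (cases n) (simp_all add: s0)
  qed auto
  also have "\<dots> = f (Suc k) \<otimes>\<^bsub>R\<^esub> s (Suc k)"
  proof (cases "Suc k \<le> deg R f")
    case True
    thus ?thesis by (intro R.finsum_singleton) auto
  next
    case False
    hence "f (Suc k) = \<zero>\<^bsub>R\<^esub>"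
      using deg_aboveD[of f "Suc k"] f by (simp add: UP_carrier)
    moreover have "(\<Oplus>\<^bsub>R\<^esub>n\<in>{..deg R f}. if Suc k = n then f n \<otimes>\<^bsub>R\<^esub> s n else \<zero>\<^bsub>R\<^esub>) = (\<Oplus>\<^bsub>R\<^esub>n\<in>{..deg R f}. \<zero>\<^bsub>R\<^esub>)"
      using False by (intro R.finsum_cong') auto
    ultimately show ?thesis by (simp add: R.finsum_zero)
  qed
  finally show "sdR_nabla R s f k = f (Suc k) \<otimes>\<^bsub>R\<^esub> s (Suc k)" .
qed

lemma sdR_nabla_closed:
  assumes s: "\<And>n. s n \<in> carrier R" and s0: "s 0 = \<zero>\<^bsub>R\<^esub>" and f: "f \<in> up R"
  shows "sdR_nabla R s f \<in> up R"
proof -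
  obtain N where N: "\<And>n. n > N \<Longrightarrow> f n = \<zero>\<^bsub>R\<^esub>" by (rule upE[OF f]) blast
  show ?thesis
    unfolding sdR_nabla_eval[where s = s, OF s s0 f]
    by (rule upI[of _ N]) (simp_all add: s mem_upD[OF f] N)
qed

lemma sdR_nabla_hom:
  assumes s: "\<And>n. s n \<in> carrier R" and s0: "s 0 = \<zero>\<^bsub>R\<^esub>"
  shows "sdR_nabla R s \<in> module_hom R (UP R) (UP R)"
proof (rule module_homI; unfold UP_carrier)
  note closed = sdR_nabla_closed[where s = s, OF s s0] and eval = sdR_nabla_eval[where s = s, OF s s0]
  fix f assume f: "f \<in> up R"
  show "sdR_nabla R s f \<in> up R" by (rule closed[OF f])
  show "sdR_nabla R s (r \<odot>\<^bsub>UP R\<^esub> f) = r \<odot>\<^bsub>UP R\<^esub> sdR_nabla R s f" if r: "r \<in> carrier R" for r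
  proof -
    have rf: "r \<odot>\<^bsub>UP R\<^esub> f \<in> up R" using r f UP_smult_closed unfolding UP_carrier by blast
    show ?thesis
      unfolding UP_eval(3)[OF r closed[OF f]]
      unfolding eval[OF rf] eval[OF f]
      unfolding UP_eval(3)[OF r f]
      using r s mem_upD[OF f] by (simp add: R.m_assoc)
  qed
  fix g assume g: "g \<in> up R"
  have fg: "f \<oplus>\<^bsub>UP R\<^esub> g \<in> up R" using f g P.a_closed unfolding UP_carrier by blast
  show "sdR_nabla R s (f \<oplus>\<^bsub>UP R\<^esub> g) = sdR_nabla R s f \<oplus>\<^bsub>UP R\<^esub> sdR_nabla R s g"
    unfolding UP_eval(2)[OF closed[OF f] closed[OF g]]
    unfolding eval[OF fg] eval[OF f] eval[OF g]
    unfolding UP_eval(2)[OF f g]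
    using mem_upD[OF f] mem_upD[OF g] s by (simp add: R.l_distr)
qed

end

section \<open>The s-de Rham complex\<close>

lemma module_hom_const_zero:
  assumes "module R N"
  shows "(\<lambda>_. \<zero>\<^bsub>N\<^esub>) \<in> module_hom R M N"
proof -
  interpret N: module R N by fact
  show ?thesis by (rule module_homI) simp_all
qed

lemma sdR_complex_simps:
  "cterm (sdR_complex R s) i = (if i = 0 \<or> i = 1 then UP R else (UP R)\<lparr>carrier := {\<zero>\<^bsub>UP R\<^esub>}\<rparr>)"
  "cdiff (sdR_complex R s) i = (if i = 0 then sdR_nabla R s else (\<lambda>_. \<zero>\<^bsub>UP R\<^esub>))"
  by (simp_all add: sdR_complex_def)

lemma sdR_complex_is_complex:
  assumes R: "cring R" and s: "generalized_n_series R s"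
  shows "is_complex R (sdR_complex R s)"
proof -
  let ?C = "sdR_complex R s"
  have P: "module R (UP R)" by (rule UP_module[OF R])
  interpret P: module R "UP R" by (rule P)
  have mods: "module R (cterm ?C j)" for j
    using P submodule.submodule_is_module[OF submodule_singleton_zero[OF P] P]
    by (simp add: sdR_complex_simps)
  have zero: "\<zero>\<^bsub>cterm ?C j\<^esub> = \<zero>\<^bsub>UP R\<^esub>" for j by (simp add: sdR_complex_simps)
  have nabla: "sdR_nabla R s \<in> module_hom R (UP R) (UP R)"
    by (rule sdR_nabla_hom[where s = s, OF R n_series_closed[OF R s] n_series_zero[OF R s]])
  have diff: "cdiff ?C j \<in> module_hom R (cterm ?C j) (cterm ?C (j + 1))" for j
  proof (cases "j = 0")
    case True
    thus ?thesis using nabla by (simp add: sdR_complex_simps)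
  next
    case False
    hence "cdiff ?C j = (\<lambda>_. \<zero>\<^bsub>cterm ?C (j + 1)\<^esub>)" by (simp only: zero sdR_complex_simps(2) if_False)
    thus ?thesis by (simp only: module_hom_const_zero[OF mods])
  qed
  have "cdiff ?C (j + 1) (cdiff ?C j x) = \<zero>\<^bsub>cterm ?C (j + 1 + 1)\<^esub>" for j x
  proof (cases "j + 1 = 0")
    case True
    hence "cdiff ?C j x = \<zero>\<^bsub>UP R\<^esub>" by (simp add: sdR_complex_simps)
    thus ?thesis using True module_hom_zero[OF P P nabla] by (simp only: zero sdR_complex_simps(2) if_True refl)
  next
    case False
    thus ?thesis by (simp only: zero sdR_complex_simps(2) if_False)
  qed
  thus ?thesis unfolding is_complex_def using mods diff by blast
qed

context
  fixes R :: "('a, 'x) ring_scheme" and s :: "nat \<Rightarrow> 'a" and p :: nat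
  assumes R: "cring R" and s: "generalized_n_series R s" and p: "Factorial_Ring.prime p"
    and unit: "(PIdl\<^bsub>R\<^esub> (s p) +>\<^bsub>R\<^esub> s 1) \<in> Units (R Quot (PIdl\<^bsub>R\<^esub> (s p)))"
begin

interpretation R: cring R by (rule R)
interpretation I: ideal "PIdl\<^bsub>R\<^esub> (s p)" R by (rule R.cgenideal_ideal[OF n_series_closed[OF R s]])

private abbreviation (input) Ip where "Ip \<equiv> PIdl\<^bsub>R\<^esub> (s p)"
private abbreviation (input) C where "C \<equiv> sdR_complex R s"
private abbreviation (input) Qp where "Qp \<equiv> quotient_ring_module R (PIdl\<^bsub>R\<^esub> (s p))"

private lemmas sc = n_series_closed[OF R s]

private lemma nabla_eval: "f \<in> up R \<Longrightarrow> sdR_nabla R s f = (\<lambda>k. f (Suc k) \<otimes>\<^bsub>R\<^esub> s (Suc k))"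
  by (rule sdR_nabla_eval[where s = s, OF R sc n_series_zero[OF R s]])

private lemma nabla_closed: "f \<in> up R \<Longrightarrow> sdR_nabla R s f \<in> up R"
  by (rule sdR_nabla_closed[where s = s, OF R sc n_series_zero[OF R s]])

lemma n_series_dvd_mem: "p dvd n \<Longrightarrow> s n \<in> Ip"
  using n_series_multiple_mem[OF R s, of p] by (auto elim!: dvdE)

text \<open>A simultaneous choice of inverses, needed to write down a primitive of a polynomial at once.\<close>

lemma n_series_inverse:
  obtains \<tau> where "\<And>n. \<tau> n \<in> carrier R"
    "\<And>n. \<not> p dvd n \<Longrightarrow> s n \<otimes>\<^bsub>R\<^esub> \<tau> n \<ominus>\<^bsub>R\<^esub> \<one>\<^bsub>R\<^esub> \<in> Ip"
proof -
  have "\<forall>n. \<exists>t. t \<in> carrier R \<and> (\<not> p dvd n \<longrightarrow> s n \<otimes>\<^bsub>R\<^esub> t \<ominus>\<^bsub>R\<^esub> \<one>\<^bsub>R\<^esub> \<in> Ip)"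
  proof
    fix n show "\<exists>t. t \<in> carrier R \<and> (\<not> p dvd n \<longrightarrow> s n \<otimes>\<^bsub>R\<^esub> t \<ominus>\<^bsub>R\<^esub> \<one>\<^bsub>R\<^esub> \<in> Ip)"
      using n_series_invertible_mod[OF R s p _ unit, of n] R.one_closed by blast
  qed
  then obtain \<tau> where "\<forall>n. \<tau> n \<in> carrier R \<and> (\<not> p dvd n \<longrightarrow> s n \<otimes>\<^bsub>R\<^esub> \<tau> n \<ominus>\<^bsub>R\<^esub> \<one>\<^bsub>R\<^esub> \<in> Ip)"
    by (rule choice[THEN exE])
  thus ?thesis using that by blast
qed

lemma n_series_cancel:
  assumes "\<not> p dvd n" and x: "x \<in> carrier R" and "x \<otimes>\<^bsub>R\<^esub> s n \<in> Ip"
  shows "x \<in> Ip"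
proof -
  obtain t where t: "t \<in> carrier R" "s n \<otimes>\<^bsub>R\<^esub> t \<ominus>\<^bsub>R\<^esub> \<one>\<^bsub>R\<^esub> \<in> Ip"
    using n_series_invertible_mod[OF R s p assms(1) unit] by blast
  have "(x \<otimes>\<^bsub>R\<^esub> s n) \<otimes>\<^bsub>R\<^esub> t \<oplus>\<^bsub>R\<^esub> (\<ominus>\<^bsub>R\<^esub> x) \<otimes>\<^bsub>R\<^esub> (s n \<otimes>\<^bsub>R\<^esub> t \<ominus>\<^bsub>R\<^esub> \<one>\<^bsub>R\<^esub>) \<in> Ip"
    by (intro I.a_closed I.I_r_closed I.I_l_closed assms t R.a_inv_closed)
  also have "(x \<otimes>\<^bsub>R\<^esub> s n) \<otimes>\<^bsub>R\<^esub> t \<oplus>\<^bsub>R\<^esub> (\<ominus>\<^bsub>R\<^esub> x) \<otimes>\<^bsub>R\<^esub> (s n \<otimes>\<^bsub>R\<^esub> t \<ominus>\<^bsub>R\<^esub> \<one>\<^bsub>R\<^esub>) = x"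
    using x t(1) sc[of n] by algebra
  finally show ?thesis .
qed

text \<open>The substitutions \<open>x^n \<mapsto> x^(np)\<close> and \<open>x^n dx \<mapsto> x^(np+p-1) dx\<close>, which play the role of the inverse
Cartier operator in degrees 0 and 1.\<close>

definition cartier0 :: "(nat \<Rightarrow> 'a) \<Rightarrow> nat \<Rightarrow> 'a"
  where "cartier0 = up_reindex R {m. p dvd m} (\<lambda>m. m div p)"

definition cartier1 :: "(nat \<Rightarrow> 'a) \<Rightarrow> nat \<Rightarrow> 'a"
  where "cartier1 = up_reindex R {m. p dvd Suc m} (\<lambda>m. Suc m div p - 1)"

private lemma p_pos: "p > 0" using p by (rule prime_gt_0_nat)

lemma cartier0_hom: "cartier0 \<in> module_hom R (UP R) (UP R)"
  unfolding cartier0_def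
  by (rule up_reindex_hom[OF R, where b = "\<lambda>n. n * p"]) (auto simp: mono_def)

lemma cartier1_hom: "cartier1 \<in> module_hom R (UP R) (UP R)"
  unfolding cartier1_def
proof (rule up_reindex_hom[OF R, where b = "\<lambda>n. (n + 1) * p"])
  fix m assume "m \<in> {m. p dvd Suc m}"
  then obtain k where k: "Suc m = p * k" by (auto elim: dvdE)
  hence "k > 0" by (cases k) auto
  thus "m \<le> (Suc m div p - 1 + 1) * p" unfolding k using k p_pos by (simp add: mult.commute)
qed (auto simp: mono_def)

private lemma cartier0_closed: "f \<in> up R \<Longrightarrow> cartier0 f \<in> up R"
  using module_homD(1)[OF cartier0_hom] by (simp add: UP_carrier[OF R])

private lemma cartier1_closed: "f \<in> up R \<Longrightarrow> cartier1 f \<in> up R"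
  using module_homD(1)[OF cartier1_hom] by (simp add: UP_carrier[OF R])

lemma cartier0_eval: "cartier0 f (n * p) = f n" "\<not> p dvd m \<Longrightarrow> cartier0 f m = \<zero>\<^bsub>R\<^esub>"
  using p_pos by (simp_all add: cartier0_def up_reindex_def[OF R])

private lemma Suc_index: "Suc (n * p + p - 1) = Suc n * p"
  using p_pos by simp

lemma cartier1_eval: "cartier1 f (n * p + p - 1) = f n" "\<not> p dvd Suc m \<Longrightarrow> cartier1 f m = \<zero>\<^bsub>R\<^esub>"
  using p_pos by (simp_all add: cartier1_def up_reindex_def[OF R] Suc_index del: mult_Suc)

text \<open>A congruence of coefficients modulo \<open>I\<close>, in the shape that \<open>reduction_cohomology_iso\<close> asks for.\<close>

lemma polynomial_congruence_witness:
  assumes g: "g \<in> up R" and u: "u \<in> up R" and v: "v \<in> up R"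
    and "\<And>m. g m \<ominus>\<^bsub>R\<^esub> (u m \<oplus>\<^bsub>R\<^esub> v m) \<in> Ip"
  shows "\<exists>k\<in>up R. g = u \<oplus>\<^bsub>UP R\<^esub> (v \<oplus>\<^bsub>UP R\<^esub> s p \<odot>\<^bsub>UP R\<^esub> k)"
proof -
  let ?d = "\<lambda>m. g m \<ominus>\<^bsub>R\<^esub> (u m \<oplus>\<^bsub>R\<^esub> v m)"
  note [simp] = mem_upD[OF g] mem_upD[OF u] mem_upD[OF v]
  have "?d \<in> up R" by (intro R.up_minus_closed R.up_add_closed g u v)
  then obtain k where k: "k \<in> up R" "?d = s p \<odot>\<^bsub>UP R\<^esub> k"
    using UP_multiple_iff[OF R sc, of ?d] assms(4) by blast
  have d: "?d m = s p \<otimes>\<^bsub>R\<^esub> k m" for m using k(2) UP_eval(3)[OF R sc k(1)] by metis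
  interpret P: module R "UP R" by (rule UP_module[OF R])
  have sk: "s p \<odot>\<^bsub>UP R\<^esub> k \<in> up R" using k(1) sc P.smult_closed by (simp add: UP_carrier[OF R])
  have vsk: "v \<oplus>\<^bsub>UP R\<^esub> s p \<odot>\<^bsub>UP R\<^esub> k \<in> up R"
    using sk v P.M.a_closed by (simp add: UP_carrier[OF R])
  have "g m = u m \<oplus>\<^bsub>R\<^esub> (v m \<oplus>\<^bsub>R\<^esub> ?d m)" for m
    using mem_upD[OF g, of m] mem_upD[OF u, of m] mem_upD[OF v, of m] by algebra
  hence "g = u \<oplus>\<^bsub>UP R\<^esub> (v \<oplus>\<^bsub>UP R\<^esub> s p \<odot>\<^bsub>UP R\<^esub> k)"
    unfolding UP_eval(2)[OF R u vsk]
    unfolding UP_eval(2)[OF R v sk]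
    unfolding UP_eval(3)[OF R sc k(1)] d
    by (rule ext)
  thus ?thesis using k(1) by blast
qed

text \<open>A multiple of \<open>p\<close> as exponent makes the derivative vanish modulo \<open>I\<close>. Conversely, if all \<open>g m s(m)\<close>
lie in \<open>I\<close>, then so does \<open>g m\<close> for each \<open>m\<close> not divisible by \<open>p\<close>, and \<open>g\<close> is congruent to the
polynomial in \<open>x^p\<close> formed by its other coefficients.\<close>

lemma cartier_iso_degree_zero:
  "\<exists>\<phi>\<in>module_iso R (tensor_product R (cterm C 0) Qp) (cohomology (tensor_complex R C Qp) 0).
    \<forall>f\<in>carrier (cterm C 0). \<phi> (pure_tensor R (cterm C 0) Qp f \<one>\<^bsub>Qp\<^esub>) =
      cohomology_class (tensor_complex R C Qp) 0 (pure_tensor R (cterm C 0) Qp (cartier0 f) \<one>\<^bsub>Qp\<^esub>)"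
proof -
  have c: "cterm C 0 = UP R" "cterm C (0 + 1) = UP R"
    "cdiff C 0 = sdR_nabla R s" "cdiff C (0 - 1) = (\<lambda>_. \<zero>\<^bsub>UP R\<^esub>)"
    "carrier (cterm C (0 - 1)) = {\<zero>\<^bsub>UP R\<^esub>}"
    by (simp_all add: sdR_complex_simps)
  interpret P: module R "UP R" by (rule UP_module[OF R])
  show ?thesis
  proof (rule reduction_cohomology_iso[OF sdR_complex_is_complex[OF R s] sc]; unfold c UP_carrier[OF R])
    show "cartier0 \<in> module_hom R (UP R) (UP R)" by (rule cartier0_hom)
    show "\<exists>k\<in>up R. sdR_nabla R s (cartier0 f) = s p \<odot>\<^bsub>UP R\<^esub> k" if f: "f \<in> up R" for f
      unfolding UP_multiple_iff[OF R sc nabla_closed[OF cartier0_closed[OF f]]]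
      unfolding nabla_eval[OF cartier0_closed[OF f]]
    proof
      fix n
      show "cartier0 f (Suc n) \<otimes>\<^bsub>R\<^esub> s (Suc n) \<in> Ip"
      proof (cases "p dvd Suc n")
        case True
        show ?thesis
          by (rule I.I_l_closed[OF n_series_dvd_mem[OF True] mem_upD[OF cartier0_closed[OF f]]])
      next
        case False
        show ?thesis unfolding cartier0_eval(2)[OF False] R.l_null[OF sc] by (rule I.zero_closed)
      qed
    qed
    show "\<exists>k'\<in>up R. f = s p \<odot>\<^bsub>UP R\<^esub> k'"
      if f: "f \<in> up R" and k: "k \<in> up R" and e: "cartier0 f = \<zero>\<^bsub>UP R\<^esub> \<oplus>\<^bsub>UP R\<^esub> s p \<odot>\<^bsub>UP R\<^esub> k" for f k
    proof -
      have "s p \<odot>\<^bsub>UP R\<^esub> k \<in> carrier (UP R)"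
        by (rule P.smult_closed[OF sc]) (simp add: UP_carrier[OF R] k)
      hence "cartier0 f = s p \<odot>\<^bsub>UP R\<^esub> k" unfolding e by (rule P.M.l_zero)
      hence "\<forall>m. cartier0 f m \<in> Ip" using UP_multiple_iff[OF R sc cartier0_closed[OF f]] k by blast
      hence "\<forall>n. f n \<in> Ip" using cartier0_eval(1) by metis
      thus ?thesis using UP_multiple_iff[OF R sc f] by blast
    qed
    show "\<exists>f\<in>up R. \<exists>h\<in>{\<zero>\<^bsub>UP R\<^esub>}. \<exists>k\<in>up R. g = cartier0 f \<oplus>\<^bsub>UP R\<^esub> (\<zero>\<^bsub>UP R\<^esub> \<oplus>\<^bsub>UP R\<^esub> s p \<odot>\<^bsub>UP R\<^esub> k)"
      if g: "g \<in> up R" and k: "k \<in> up R" and e: "sdR_nabla R s g = s p \<odot>\<^bsub>UP R\<^esub> k" for g k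
    proof -
      have gI: "g m \<in> Ip" if m: "\<not> p dvd m" for m
      proof -
        obtain n where n: "m = Suc n" using m by (cases m) auto
        have "\<forall>n. sdR_nabla R s g n \<in> Ip" using UP_multiple_iff[OF R sc nabla_closed[OF g]] e k by blast
        hence "g m \<otimes>\<^bsub>R\<^esub> s m \<in> Ip" unfolding nabla_eval[OF g] n by blast
        thus ?thesis by (rule n_series_cancel[OF m mem_upD[OF g]])
      qed
      \<comment> \<open>the polynomial \<open>f\<close> with \<open>f(x^p)\<close> equal to the part of \<open>g\<close> with exponents divisible by \<open>p\<close>\<close>
      define f where "f = up_reindex R UNIV (\<lambda>n. n * p) g"
      have f: "f \<in> up R" unfolding f_def
        by (rule up_reindex_closed[OF R, where b = "\<lambda>n. n"]) (use p_pos g in \<open>auto simp: mono_def\<close>)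
      have z: "\<zero>\<^bsub>UP R\<^esub> \<in> up R" using P.M.zero_closed by (simp add: UP_carrier[OF R])
      have "\<exists>k\<in>up R. g = cartier0 f \<oplus>\<^bsub>UP R\<^esub> (\<zero>\<^bsub>UP R\<^esub> \<oplus>\<^bsub>UP R\<^esub> s p \<odot>\<^bsub>UP R\<^esub> k)"
      proof (rule polynomial_congruence_witness[OF g cartier0_closed[OF f] z])
        fix m
        have gm: "g m \<in> carrier R" by (rule mem_upD[OF g])
        show "g m \<ominus>\<^bsub>R\<^esub> (cartier0 f m \<oplus>\<^bsub>R\<^esub> \<zero>\<^bsub>UP R\<^esub> m) \<in> Ip"
        proof (cases "p dvd m")
          case True
          then obtain n where m: "m = n * p" by (metis dvd_div_mult_self)
          have "cartier0 f m = g m" unfolding m cartier0_eval(1) by (simp add: f_def up_reindex_def[OF R])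
          hence "g m \<ominus>\<^bsub>R\<^esub> (cartier0 f m \<oplus>\<^bsub>R\<^esub> \<zero>\<^bsub>UP R\<^esub> m) = \<zero>\<^bsub>R\<^esub>"
            using gm by (simp add: UP_eval(4)[OF R] a_minus_def R.r_neg)
          thus ?thesis using I.zero_closed by (simp only:)
        next
          case False
          have "g m \<ominus>\<^bsub>R\<^esub> (cartier0 f m \<oplus>\<^bsub>R\<^esub> \<zero>\<^bsub>UP R\<^esub> m) = g m"
            using gm by (simp add: UP_eval(4)[OF R] a_minus_def cartier0_eval(2)[OF False])
          thus ?thesis using gI[OF False] by (simp only:)
        qed
      qed
      thus ?thesis using f by blast
    qed
  qed
qed

text \<open>Every form is a cocycle. Coboundaries have coefficients in \<open>I\<close> at the exponents \<open>np + p - 1\<close>, because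
\<open>s((n+1)p)\<close> occurs there as a factor. At every other exponent a form can be integrated modulo \<open>I\<close>.\<close>

lemma cartier_iso_degree_one:
  "\<exists>\<phi>\<in>module_iso R (tensor_product R (cterm C 1) Qp) (cohomology (tensor_complex R C Qp) 1).
    \<forall>f\<in>carrier (cterm C 1). \<phi> (pure_tensor R (cterm C 1) Qp f \<one>\<^bsub>Qp\<^esub>) =
      cohomology_class (tensor_complex R C Qp) 1 (pure_tensor R (cterm C 1) Qp (cartier1 f) \<one>\<^bsub>Qp\<^esub>)"
proof -
  have c: "cterm C 1 = UP R" "cterm C (1 - 1) = UP R"
    "cdiff C 1 = (\<lambda>_. \<zero>\<^bsub>UP R\<^esub>)" "cdiff C (1 - 1) = sdR_nabla R s"
    by (simp_all add: sdR_complex_simps)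
  interpret P: module R "UP R" by (rule UP_module[OF R])
  interpret C2: module R "cterm C (1 + 1)" by (rule is_complexD(1)[OF sdR_complex_is_complex[OF R s]])
  have z: "\<zero>\<^bsub>UP R\<^esub> = \<zero>\<^bsub>cterm C (1 + 1)\<^esub>" by (simp add: sdR_complex_simps)
  show ?thesis
  proof (rule reduction_cohomology_iso[OF sdR_complex_is_complex[OF R s] sc]; unfold c UP_carrier[OF R])
    show "cartier1 \<in> module_hom R (UP R) (UP R)" by (rule cartier1_hom)
    show "\<exists>k\<in>carrier (cterm C (1 + 1)). \<zero>\<^bsub>UP R\<^esub> = s p \<odot>\<^bsub>cterm C (1 + 1)\<^esub> k"
      unfolding z by (rule bexI[OF _ C2.M.zero_closed]) (rule C2.smult_r_null[OF sc, symmetric])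
    show "\<exists>k'\<in>up R. f = s p \<odot>\<^bsub>UP R\<^esub> k'"
      if f: "f \<in> up R" and h: "h \<in> up R" and k: "k \<in> up R"
        and e: "cartier1 f = sdR_nabla R s h \<oplus>\<^bsub>UP R\<^esub> s p \<odot>\<^bsub>UP R\<^esub> k" for f h k
      unfolding UP_multiple_iff[OF R sc f]
    proof
      fix n
      let ?m = "n * p + p - 1"
      have sk: "s p \<odot>\<^bsub>UP R\<^esub> k \<in> up R" using k sc P.smult_closed by (simp add: UP_carrier[OF R])
      have "f n = cartier1 f ?m" by (rule cartier1_eval(1)[symmetric])
      also have "\<dots> = h (Suc n * p) \<otimes>\<^bsub>R\<^esub> s (Suc n * p) \<oplus>\<^bsub>R\<^esub> s p \<otimes>\<^bsub>R\<^esub> k ?m"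
        unfolding e UP_eval(2)[OF R nabla_closed[OF h] sk]
        unfolding UP_eval(3)[OF R sc k] nabla_eval[OF h] Suc_index ..
      also have "\<dots> \<in> Ip"
        by (intro I.a_closed I.I_l_closed I.I_r_closed n_series_dvd_mem mem_upD[OF h] mem_upD[OF k]
            R.cgenideal_self[OF sc]) simp
      finally show "f n \<in> Ip" .
    qed
    show "\<exists>f\<in>up R. \<exists>h\<in>up R. \<exists>k\<in>up R. g = cartier1 f \<oplus>\<^bsub>UP R\<^esub> (sdR_nabla R s h \<oplus>\<^bsub>UP R\<^esub> s p \<odot>\<^bsub>UP R\<^esub> k)"
      if g: "g \<in> up R" for g
    proof -
      obtain \<tau> where \<tau>: "\<And>n. \<tau> n \<in> carrier R"
        "\<And>n. \<not> p dvd n \<Longrightarrow> s n \<otimes>\<^bsub>R\<^esub> \<tau> n \<ominus>\<^bsub>R\<^esub> \<one>\<^bsub>R\<^esub> \<in> Ip" by (rule n_series_inverse) blast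
      define f where "f = up_reindex R UNIV (\<lambda>n. n * p + p - 1) g"
      have f: "f \<in> up R" unfolding f_def
      proof (rule up_reindex_closed[OF R, where b = "\<lambda>n. n"])
        show "m \<le> m * p + p - 1" for m
        using p_pos by (cases p) simp_all
      qed (use g in \<open>auto simp: mono_def\<close>)
      \<comment> \<open>a primitive, modulo \<open>I\<close>, of the part of \<open>g\<close> with exponents not of the form \<open>np + p - 1\<close>\<close>
      define h where "h m = (if p dvd m then \<zero>\<^bsub>R\<^esub> else g (m - 1) \<otimes>\<^bsub>R\<^esub> \<tau> m)" for m
      obtain N where N: "\<And>n. n > N \<Longrightarrow> g n = \<zero>\<^bsub>R\<^esub>" by (rule upE[OF R g]) blast
      have h: "h \<in> up R"
        by (rule upI[OF R, where N = "Suc N"]) (simp_all add: h_def \<tau> mem_upD[OF g] N)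
      have "\<exists>k\<in>up R. g = cartier1 f \<oplus>\<^bsub>UP R\<^esub> (sdR_nabla R s h \<oplus>\<^bsub>UP R\<^esub> s p \<odot>\<^bsub>UP R\<^esub> k)"
      proof (rule polynomial_congruence_witness[OF g cartier1_closed[OF f] nabla_closed[OF h]])
        fix m
        have gm: "g m \<in> carrier R" by (rule mem_upD[OF g])
        show "g m \<ominus>\<^bsub>R\<^esub> (cartier1 f m \<oplus>\<^bsub>R\<^esub> sdR_nabla R s h m) \<in> Ip"
        proof (cases "p dvd Suc m")
          case True
          then obtain k where k: "Suc m = p * k" by (auto elim: dvdE)
          then obtain n where n: "k = Suc n" by (cases k) auto
          have m: "m = n * p + p - 1" using k unfolding n by (simp add: mult.commute)
          have "cartier1 f m = g m" unfolding m cartier1_eval(1) by (simp add: f_def up_reindex_def[OF R])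
          moreover have "sdR_nabla R s h m = \<zero>\<^bsub>R\<^esub>"
            using True sc by (simp add: nabla_eval[OF h] h_def)
          ultimately have "g m \<ominus>\<^bsub>R\<^esub> (cartier1 f m \<oplus>\<^bsub>R\<^esub> sdR_nabla R s h m) = \<zero>\<^bsub>R\<^esub>"
            using gm by (simp add: a_minus_def R.r_neg)
          thus ?thesis using I.zero_closed by (simp only:)
        next
          case False
          have "sdR_nabla R s h m = g m \<otimes>\<^bsub>R\<^esub> \<tau> (Suc m) \<otimes>\<^bsub>R\<^esub> s (Suc m)"
            using False by (simp add: nabla_eval[OF h] h_def)
          hence "g m \<ominus>\<^bsub>R\<^esub> (cartier1 f m \<oplus>\<^bsub>R\<^esub> sdR_nabla R s h m) =
              g m \<ominus>\<^bsub>R\<^esub> (\<zero>\<^bsub>R\<^esub> \<oplus>\<^bsub>R\<^esub> g m \<otimes>\<^bsub>R\<^esub> \<tau> (Suc m) \<otimes>\<^bsub>R\<^esub> s (Suc m))"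
            by (simp only: cartier1_eval(2)[OF False])
          also have "\<dots> = (\<ominus>\<^bsub>R\<^esub> g m) \<otimes>\<^bsub>R\<^esub> (s (Suc m) \<otimes>\<^bsub>R\<^esub> \<tau> (Suc m) \<ominus>\<^bsub>R\<^esub> \<one>\<^bsub>R\<^esub>)"
            using gm \<tau>(1)[of "Suc m"] sc[of "Suc m"] by algebra
          also have "\<dots> \<in> Ip" by (rule I.I_l_closed[OF \<tau>(2)[OF False] R.a_inv_closed[OF gm]])
          finally show ?thesis .
        qed
      qed
      thus ?thesis using f h by blast
    qed
  qed
qed

lemma cartier_iso_other_degrees:
  assumes "i \<noteq> 0" "i \<noteq> 1"
  shows "\<exists>\<phi>. \<phi> \<in> module_iso R (tensor_product R (cterm C i) Qp) (cohomology (tensor_complex R C Qp) i)"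
proof -
  have c: "carrier (cterm C i) = {\<zero>\<^bsub>UP R\<^esub>}" "cdiff C i = (\<lambda>_. \<zero>\<^bsub>UP R\<^esub>)"
    using assms by (simp_all add: sdR_complex_simps)
  have z: "\<zero>\<^bsub>UP R\<^esub> = \<zero>\<^bsub>cterm C j\<^esub>" for j by (simp add: sdR_complex_simps)
  note C = sdR_complex_is_complex[OF R s]
  interpret C0: module R "cterm C (i - 1)" by (rule is_complexD(1)[OF C])
  interpret C1: module R "cterm C i" by (rule is_complexD(1)[OF C])
  interpret C2: module R "cterm C (i + 1)" by (rule is_complexD(1)[OF C])
  have zi: "x = \<zero>\<^bsub>cterm C i\<^esub>" if "x \<in> carrier (cterm C i)" for x
    using that unfolding c(1) z[of i, symmetric] by (rule singletonD)
  have "\<exists>\<phi>\<in>module_iso R (tensor_product R (cterm C i) Qp) (cohomology (tensor_complex R C Qp) i).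
    \<forall>f\<in>carrier (cterm C i). \<phi> (pure_tensor R (cterm C i) Qp f \<one>\<^bsub>Qp\<^esub>) =
      cohomology_class (tensor_complex R C Qp) i (pure_tensor R (cterm C i) Qp (id f) \<one>\<^bsub>Qp\<^esub>)"
  proof (rule reduction_cohomology_iso[OF C sc module_hom_id])
    have null: "s p \<odot>\<^bsub>cterm C i\<^esub> \<zero>\<^bsub>cterm C i\<^esub> = \<zero>\<^bsub>cterm C i\<^esub>" by (rule C1.smult_r_null[OF sc])
    show "\<exists>k\<in>carrier (cterm C (i + 1)). cdiff C i (id f) = s p \<odot>\<^bsub>cterm C (i + 1)\<^esub> k" for f
      unfolding c(2) z[of "i + 1"]
      by (rule bexI[OF _ C2.M.zero_closed]) (rule C2.smult_r_null[OF sc, symmetric])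
    show "\<exists>k'\<in>carrier (cterm C i). f = s p \<odot>\<^bsub>cterm C i\<^esub> k'" if "f \<in> carrier (cterm C i)" for f
      using zi[OF that] null C1.M.zero_closed by metis
    show "\<exists>f\<in>carrier (cterm C i). \<exists>h\<in>carrier (cterm C (i - 1)). \<exists>k\<in>carrier (cterm C i).
        g = id f \<oplus>\<^bsub>cterm C i\<^esub> (cdiff C (i - 1) h \<oplus>\<^bsub>cterm C i\<^esub> s p \<odot>\<^bsub>cterm C i\<^esub> k)"
      if "g \<in> carrier (cterm C i)" for g
    proof (intro bexI)
      let ?h = "\<zero>\<^bsub>cterm C (i - 1)\<^esub>" and ?z = "\<zero>\<^bsub>cterm C i\<^esub>"
      have "cdiff C (i - 1) ?h \<in> carrier (cterm C i)"
        by (rule module_homD(1)[OF is_complexD(3)[OF C] C0.M.zero_closed])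
      hence "id ?z \<oplus>\<^bsub>cterm C i\<^esub> (cdiff C (i - 1) ?h \<oplus>\<^bsub>cterm C i\<^esub> s p \<odot>\<^bsub>cterm C i\<^esub> ?z) \<in> carrier (cterm C i)"
        using sc by simp
      thus "g = id ?z \<oplus>\<^bsub>cterm C i\<^esub> (cdiff C (i - 1) ?h \<oplus>\<^bsub>cterm C i\<^esub> s p \<odot>\<^bsub>cterm C i\<^esub> ?z)"
        using zi[OF that] zi by metis
    qed simp_all
  qed
  thus ?thesis by blast
qed

lemma cartier0_monom: "cartier0 (monom (UP R) \<one>\<^bsub>R\<^esub> n) = monom (UP R) \<one>\<^bsub>R\<^esub> (n * p)"
  using p_pos by (auto simp: UP_eval(5)[OF R] cartier0_def up_reindex_def[OF R] fun_eq_iff elim!: dvdE)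

lemma cartier1_monom:
  "cartier1 (monom (UP R) \<one>\<^bsub>R\<^esub> n) =
    monom (UP R) \<one>\<^bsub>R\<^esub> (n * p) \<otimes>\<^bsub>UP R\<^esub> monom (UP R) \<one>\<^bsub>R\<^esub> (p - 1)"
proof -
  interpret UP_cring R "UP R" by unfold_locales
  have "monom (UP R) \<one>\<^bsub>R\<^esub> (n * p) \<otimes>\<^bsub>UP R\<^esub> monom (UP R) \<one>\<^bsub>R\<^esub> (p - 1) = monom (UP R) \<one>\<^bsub>R\<^esub> (n * p + p - 1)"
    using monom_mult[of "\<one>\<^bsub>R\<^esub>" "\<one>\<^bsub>R\<^esub>" "n * p" "p - 1"] p_pos by simp
  moreover have "cartier1 (monom (UP R) \<one>\<^bsub>R\<^esub> n) m = monom (UP R) \<one>\<^bsub>R\<^esub> (n * p + p - 1) m" for m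
  proof (cases "p dvd Suc m")
    case True
    then obtain k where k: "Suc m = p * k" by (auto elim: dvdE)
    then obtain l where l: "k = Suc l" by (cases k) auto
    have m: "m = l * p + p - 1" using k unfolding l by (simp add: mult.commute)
    have "m = n * p + p - 1 \<longleftrightarrow> Suc m = Suc (n * p + p - 1)" by simp
    also have "\<dots> \<longleftrightarrow> l = n" unfolding Suc_index m using p_pos by (simp del: mult_Suc)
    finally have "m = n * p + p - 1 \<longleftrightarrow> l = n" .
    moreover have "cartier1 (monom (UP R) \<one>\<^bsub>R\<^esub> n) m = monom (UP R) \<one>\<^bsub>R\<^esub> n l"
      unfolding m by (rule cartier1_eval(1))
    ultimately show ?thesis by (simp add: UP_eval(5)[OF R])
  next
    case False
    hence "m \<noteq> n * p + p - 1" using Suc_index[of n] by (metis dvd_triv_right)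
    thus ?thesis by (simp add: UP_eval(5)[OF R] cartier1_eval(2)[OF False])
  qed
  ultimately show ?thesis by (simp add: fun_eq_iff)
qed

end

theorem proposition4p2p4:
  fixes R :: "('a, 'x) ring_scheme" and s :: "nat \<Rightarrow> 'a" and p :: nat and i :: int
  defines "Rp \<equiv> quotient_ring_module R (PIdl\<^bsub>R\<^esub> (s p))"
  defines "C \<equiv> sdR_complex R s"
  defines "Cp \<equiv> tensor_complex R C Rp"
  assumes "Factorial_Ring.prime p"
    and "cring R"
    and "generalized_n_series R s"
    and "(PIdl\<^bsub>R\<^esub> (s p) +>\<^bsub>R\<^esub> s 1) \<in> Units (R Quot (PIdl\<^bsub>R\<^esub> (s p)))"
  shows "\<exists>\<phi> \<in> module_iso R (tensor_product R (cterm C i) Rp) (cohomology Cp i).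
    (i = 0 \<longrightarrow> (\<forall>n. \<phi> (pure_tensor R (cterm C 0) Rp (monom (UP R) \<one>\<^bsub>R\<^esub> n) \<one>\<^bsub>Rp\<^esub>) =
      cohomology_class Cp 0
        (pure_tensor R (cterm C 0) Rp (monom (UP R) \<one>\<^bsub>R\<^esub> (n * p)) \<one>\<^bsub>Rp\<^esub>))) \<and>
    (i = 1 \<longrightarrow> (\<forall>n. \<phi> (pure_tensor R (cterm C 1) Rp (monom (UP R) \<one>\<^bsub>R\<^esub> n) \<one>\<^bsub>Rp\<^esub>) =
      cohomology_class Cp 1
        (pure_tensor R (cterm C 1) Rp
          (monom (UP R) \<one>\<^bsub>R\<^esub> (n * p) \<otimes>\<^bsub>UP R\<^esub> monom (UP R) \<one>\<^bsub>R\<^esub> (p - 1)) \<one>\<^bsub>Rp\<^esub>)))"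
proof -
  note h = assms(5,6,4,7)
  interpret R: cring R by fact
  interpret UP_cring R "UP R" by unfold_locales
  have mon: "monom (UP R) \<one>\<^bsub>R\<^esub> n \<in> carrier (cterm C j)" if "j = 0 \<or> j = 1" for n j
    using that by (auto simp: C_def sdR_complex_simps)
  consider "i = 0" | "i = 1" | "i \<noteq> 0" "i \<noteq> 1" by blast
  thus ?thesis
  proof cases
    case 1
    obtain \<phi> where \<phi>: "\<phi> \<in> module_iso R (tensor_product R (cterm C 0) Rp) (cohomology Cp 0)"
      "\<forall>f\<in>carrier (cterm C 0). \<phi> (pure_tensor R (cterm C 0) Rp f \<one>\<^bsub>Rp\<^esub>) =
        cohomology_class Cp 0 (pure_tensor R (cterm C 0) Rp (cartier0 R p f) \<one>\<^bsub>Rp\<^esub>)"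
      using cartier_iso_degree_zero[OF h] unfolding Cp_def C_def Rp_def by blast
    show ?thesis
      using \<phi>(1) bspec[OF \<phi>(2) mon[of 0]] cartier0_monom[OF h] 1 by (intro bexI[of _ \<phi>]) simp_all
  next
    case 2
    obtain \<phi> where \<phi>: "\<phi> \<in> module_iso R (tensor_product R (cterm C 1) Rp) (cohomology Cp 1)"
      "\<forall>f\<in>carrier (cterm C 1). \<phi> (pure_tensor R (cterm C 1) Rp f \<one>\<^bsub>Rp\<^esub>) =
        cohomology_class Cp 1 (pure_tensor R (cterm C 1) Rp (cartier1 R p f) \<one>\<^bsub>Rp\<^esub>)"
      using cartier_iso_degree_one[OF h] unfolding Cp_def C_def Rp_def by blast
    show ?thesis
      using \<phi>(1) bspec[OF \<phi>(2) mon[of 1]] cartier1_monom[OF h] 2 by (intro bexI[of _ \<phi>]) simp_all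
  next
    case 3
    thus ?thesis using cartier_iso_other_degrees[OF h] unfolding Cp_def C_def Rp_def by blast
  qed
qed

end
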